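(* Let $\mu_1\le\mu_2\le\mu_3<0$ and consider the system $$u_i''+2(u_1^2+u_2^2+u_3^2)u_i=-\mu_iu_i\quad\text{in }\mathbb{R},\qquad i=1,2,3.\qquad( * )$$ (i) If $u=(u_1,u_2,u_3)\in H^1(\mathbb{R})^3$ is a least energy normalized solution of $( * )$, then necessarily $\mu_1=\mu_2=\mu_3=-\frac94$, and, up to a translation, $u$ must satisfy $$u_1(x)\equiv\pm\frac{\sqrt3}{2\cosh(\frac{3x}{2})},\quad u_2(x)\equiv\pm\frac{\sqrt3}{2\cosh(\frac{3x}{2})},\quad u_3(x)\equiv\pm\frac{\sqrt3}{2\cosh(\frac{3x}{2})}$$ for three uncorrelated signs $\pm$. (ii) The system $( * )$ does not admit any orthonormal solution $u=(u_1,u_2,u_3)\in H^1(\mathbb{R})^3$, i.e. any solution satisfying $\int_{\mathbb{R}}u_iu_j\,dx=\delta_{ij}$ for all $1\le i\le j\le3$.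
   Context: All functions are real-valued. Define the energy $$E(v_1,v_2,v_3)=\sum_{k=1}^3\int_{\mathbb{R}}(v_k')^2dx-\int_{\mathbb{R}}\Big(\sum_{k=1}^3v_k^2\Big)^2dx.$$ A least energy normalized solution of $( * )$ is a solution $u=(u_1,u_2,u_3)\in H^1(\mathbb{R})^3$ of $( * )$ with $\int_{\mathbb{R}}u_i^2dx=1$ for $i=1,2,3$ such that $$E(u_1,u_2,u_3)=\inf E(v_1,v_2,v_3),$$ where the infimum is over all $(v_1,v_2,v_3)\in H^1(\mathbb{R})^3$ which satisfy $v_i''+2(v_1^2+v_2^2+v_3^2)v_i=-\nu_iv_i$ in $\mathbb{R}$ ($i=1,2,3$) for some $\nu_1\le\nu_2\le\nu_3<0$ (depending on $v$, not fixed in advance), and $\int_{\mathbb{R}}v_i^2dx=1$ for $i=1,2,3$. *)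

theory Defs
  imports "HOL-Analysis.Analysis"
begin

text \<open>
  Elements of $L^2$ and $H^1$ are represented by real functions on the line, so equality in these
  spaces is equality almost everywhere.
\<close>

definition test_function :: "(real \<Rightarrow> real) \<Rightarrow> bool" where
  "test_function \<phi> \<longleftrightarrow>
     (\<forall>n x. (deriv ^^ n) \<phi> differentiable (at x)) \<and> compact (closure {x. \<phi> x \<noteq> 0})"

definition locally_integrable :: "(real \<Rightarrow> real) \<Rightarrow> bool" where
  "locally_integrable f \<longleftrightarrow> (\<forall>a b. set_integrable lebesgue {a..b} f)"

definition has_weak_deriv :: "(real \<Rightarrow> real) \<Rightarrow> (real \<Rightarrow> real) \<Rightarrow> bool" where
  "has_weak_deriv f g \<longleftrightarrow> locally_integrable f \<and> locally_integrable g \<and>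
     (\<forall>\<phi>. test_function \<phi> \<longrightarrow>
       (\<integral>x. f x * deriv \<phi> x \<partial>lebesgue) = - (\<integral>x. g x * \<phi> x \<partial>lebesgue))"

text \<open>The choice is immaterial: weak derivatives are unique up to null sets.\<close>

definition weak_deriv :: "(real \<Rightarrow> real) \<Rightarrow> real \<Rightarrow> real" where
  "weak_deriv f = (SOME g. has_weak_deriv f g)"

definition L2 :: "(real \<Rightarrow> real) set" where
  "L2 = {f. f \<in> borel_measurable lebesgue \<and> integrable lebesgue (\<lambda>x. (f x)\<^sup>2)}"

definition H1 :: "(real \<Rightarrow> real) set" where
  "H1 = {f \<in> L2. \<exists>g \<in> L2. has_weak_deriv f g}"

text \<open>
  A triple $(v_1,v_2,v_3)$ is a family indexed by natural numbers of which only the members with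
  index 1, 2, 3 matter.
\<close>

definition energy :: "(nat \<Rightarrow> real \<Rightarrow> real) \<Rightarrow> real" where
  "energy v = (\<Sum>k=1..3. \<integral>x. (weak_deriv (v k) x)\<^sup>2 \<partial>lebesgue)
     - (\<integral>x. (\<Sum>k=1..3. (v k x)\<^sup>2)\<^sup>2 \<partial>lebesgue)"

text \<open>
  Solutions in $H^1$ satisfy the equations weakly; below, \<open>w\<close> is the second
  derivative of \<open>u i\<close> in the sense of distributions.
\<close>

definition H1_solution :: "(nat \<Rightarrow> real) \<Rightarrow> (nat \<Rightarrow> real \<Rightarrow> real) \<Rightarrow> bool" where
  "H1_solution \<mu> u \<longleftrightarrow> (\<forall>i\<in>{1..3}. u i \<in> H1) \<and>
     (\<forall>i\<in>{1..3}. \<exists>w. has_weak_deriv (weak_deriv (u i)) w \<and>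
       (AE x in lebesgue. w x + 2 * ((u 1 x)\<^sup>2 + (u 2 x)\<^sup>2 + (u 3 x)\<^sup>2) * u i x = - \<mu> i * u i x))"

definition normalized :: "(nat \<Rightarrow> real \<Rightarrow> real) \<Rightarrow> bool" where
  "normalized u \<longleftrightarrow> (\<forall>i\<in>{1..3}. (\<integral>x. (u i x)\<^sup>2 \<partial>lebesgue) = 1)"

definition orthonormal :: "(nat \<Rightarrow> real \<Rightarrow> real) \<Rightarrow> bool" where
  "orthonormal u \<longleftrightarrow> (\<forall>i j. 1 \<le> i \<and> i \<le> j \<and> j \<le> 3 \<longrightarrow>
     (\<integral>x. u i x * u j x \<partial>lebesgue) = (if i = j then 1 else 0))"

definition admissible :: "(nat \<Rightarrow> real \<Rightarrow> real) set" where
  "admissible = {v. normalized v \<and>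
     (\<exists>\<nu>. \<nu> 1 \<le> \<nu> 2 \<and> \<nu> 2 \<le> \<nu> 3 \<and> \<nu> 3 < 0 \<and> H1_solution \<nu> v)}"

text \<open>The infimum is taken in the extended reals so that it is meaningful without a lower bound.\<close>

definition least_energy_normalized_solution ::
    "(nat \<Rightarrow> real) \<Rightarrow> (nat \<Rightarrow> real \<Rightarrow> real) \<Rightarrow> bool" where
  "least_energy_normalized_solution \<mu> u \<longleftrightarrow> H1_solution \<mu> u \<and> normalized u \<and>
     ereal (energy u) = (INF v\<in>admissible. ereal (energy v))"

end

theory Submission
  imports Defs
begin

text \<open>
  Write \<open>\<mu> i = - (k i)\<^sup>2\<close> with \<open>k i > 0\<close>, let \<open>K\<close> be the diagonal matrix of the \<open>k i\<close>, and
  for a solution \<open>u\<close> let \<open>M x\<close> be the matrix of the tail integrals of \<open>u i * u j\<close> over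
  \<open>{x..}\<close>. As \<open>x\<close> tends to minus infinity, \<open>M\<close> tends to the Gram matrix \<open>G\<close> of the components.

  The Gelfand-Levitan theory of reflectionless potentials suggests the two identities
  \<open>u' = M u - K u\<close> and \<open>K M + M K - M\<^sup>2 = u u\<^sup>T\<close>. They are proved here without
  inverse scattering. Let \<open>d = u' - M u + K u\<close> and \<open>C = K M + M K - M\<^sup>2 - u u\<^sup>T\<close> be the
  defects. The equations for \<open>u\<close> give the linear homogeneous system
  \<open>d' = (K - M) d + C u\<close>, \<open>C' = - (d u\<^sup>T + u d\<^sup>T)\<close>, in which the mixed terms cancel in
  the derivative of \<open>2 |d|\<^sup>2 + |C|\<^sup>2\<close>: what is left is \<open>4 d \<bullet> (K - M) d\<close>. Since \<open>M\<close> tends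
  to \<open>0\<close> at infinity, this is nonnegative far to the right, so a nonnegative function that
  increases to \<open>0\<close> has to vanish there; a linear differential inequality carries the zero to the
  whole line (\<open>lyapunov_eq_0\<close>). Coinciding or distinct \<open>k i\<close> are treated alike.

  At minus infinity the second identity becomes \<open>K G + G K = G\<^sup>2\<close> (\<open>gram_identity\<close>), and both
  parts of the theorem follow from it.

  \<^item> For normalized components the diagonal of this equation reads
    \<open>2 * k i = (\<Sum>l. (G i l)\<^sup>2)\<close>, which is at most 3 by the Cauchy-Schwarz inequality; so
    \<open>k i \<le> 3 / 2\<close>. The virial and the first integral of the system give the energy
    \<open>- (\<Sum>i. (k i)\<^sup>2) / 3\<close>, and the triple of equal solitons has energy \<open>- 9 / 4\<close>. A solution of
    least energy therefore has \<open>k i = 3 / 2\<close> and \<open>\<bar>G i j\<bar> = 1\<close> throughout. Equality in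
    Cauchy-Schwarz makes the components equal up to sign, the tail integral of their common square
    then satisfies a logistic equation, and its solution is the square of a hyperbolic secant.

  \<^item> If the components are orthonormal, then \<open>G = 1\<close> forces all \<open>k i\<close> to be \<open>1 / 2\<close>. But
    decaying solutions of one and the same linear equation are proportional, which contradicts
    orthogonality.

  All this needs classical solutions. A function with a weak derivative is almost everywhere equal
  to a continuous one (du Bois-Reymond); applied to \<open>u\<close>, this makes the right-hand side of the
  equation continuous, whence \<open>u\<close> is twice continuously differentiable after a change on a null
  set.
\<close>

section \<open>Smooth functions\<close>

definition smooth :: "(real \<Rightarrow> real) \<Rightarrow> bool" where
  "smooth f \<longleftrightarrow> (\<forall>n x. (deriv ^^ n) f differentiable (at x))"

text \<open>
  The derivatives of one function are rarely available in closed form. It is enough to find a class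
  of differentiable functions that contains it and is stable under differentiation.
\<close>

lemma smoothI_deriv_closed:
  assumes "f \<in> A"
    and "\<And>g x. g \<in> A \<Longrightarrow> g differentiable (at x)"
    and "\<And>g. g \<in> A \<Longrightarrow> deriv g \<in> A"
  shows "smooth f"
proof -
  have "(deriv ^^ n) f \<in> A" for n
    by (induction n) (auto simp: assms)
  then show ?thesis
    using assms(2) unfolding smooth_def by blast
qed

lemma smooth_imp_has_deriv:
  assumes "smooth f"
  shows "(f has_real_derivative deriv f x) (at x)"
  using assms[unfolded smooth_def, rule_format, of 0 x]
  by (simp add: DERIV_deriv_iff_real_differentiable)

lemma smooth_imp_differentiable: "smooth f \<Longrightarrow> f differentiable (at x)"
  using smooth_def[of f] by (metis funpow_0)

lemma smooth_imp_continuous_on: "smooth f \<Longrightarrow> continuous_on A f"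
  by (meson DERIV_isCont continuous_at_imp_continuous_on smooth_imp_has_deriv)

lemma smooth_deriv: "smooth f \<Longrightarrow> smooth (deriv f)"
  unfolding smooth_def by (metis funpow_Suc_right comp_apply)

lemma smooth_antideriv:
  assumes "\<And>x. (F has_real_derivative f x) (at x)" and "smooth f"
  shows "smooth F"
proof -
  have dF: "deriv F = f"
    using assms(1) by (auto intro: DERIV_imp_deriv)
  show ?thesis
  proof (rule smoothI_deriv_closed[of F "insert F {g. smooth g}"])
    show "g differentiable (at x)" if "g \<in> insert F {g. smooth g}" for g x
      using that assms(1) smooth_imp_differentiable
      by (auto simp: real_differentiable_def)
    show "deriv g \<in> insert F {g. smooth g}" if "g \<in> insert F {g. smooth g}" for g
      using that assms(2) smooth_deriv by (auto simp: dF)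
  qed simp
qed

text \<open>
  Sums of products of smooth functions: by the product rule this class is stable under
  differentiation, which spares the general Leibniz formula.
\<close>

inductive_set smooth_algebra :: "(real \<Rightarrow> real) set" where
  mult: "smooth f \<Longrightarrow> smooth g \<Longrightarrow> (\<lambda>x. f x * g x) \<in> smooth_algebra"
| add: "f \<in> smooth_algebra \<Longrightarrow> g \<in> smooth_algebra \<Longrightarrow> (\<lambda>x. f x + g x) \<in> smooth_algebra"

lemma smooth_algebra_deriv:
  "f \<in> smooth_algebra \<Longrightarrow> (\<forall>x. f differentiable (at x)) \<and> deriv f \<in> smooth_algebra"
proof (induction rule: smooth_algebra.induct)
  case (mult f g)
  have d: "((\<lambda>x. f x * g x) has_real_derivative deriv f x * g x + f x * deriv g x) (at x)" for x
    using DERIV_mult[OF mult[THEN smooth_imp_has_deriv], of x] by (simp add: mult.commute add.commute)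
  then have "deriv (\<lambda>x. f x * g x) = (\<lambda>x. deriv f x * g x + f x * deriv g x)"
    by (intro ext DERIV_imp_deriv)
  moreover have "(\<lambda>x. deriv f x * g x + f x * deriv g x) \<in> smooth_algebra"
    by (intro smooth_algebra.intros smooth_deriv mult)
  ultimately show ?case
    using d by (auto simp: real_differentiable_def)
next
  case (add f g)
  then have d: "((\<lambda>x. f x + g x) has_real_derivative deriv f x + deriv g x) (at x)" for x
    by (intro DERIV_add) (auto simp: DERIV_deriv_iff_real_differentiable)
  then have "deriv (\<lambda>x. f x + g x) = (\<lambda>x. deriv f x + deriv g x)"
    by (intro ext DERIV_imp_deriv)
  with d add show ?case
    by (auto simp: real_differentiable_def intro: smooth_algebra.add)
qed

lemma smooth_algebra_smooth: "f \<in> smooth_algebra \<Longrightarrow> smooth f"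
  using smoothI_deriv_closed[of f smooth_algebra] smooth_algebra_deriv by blast

lemma smooth_mult: "smooth f \<Longrightarrow> smooth g \<Longrightarrow> smooth (\<lambda>x. f x * g x)"
  by (rule smooth_algebra_smooth[OF smooth_algebra.mult])

lemma smooth_const: "smooth (\<lambda>x. c)"
  by (rule smoothI_deriv_closed[of _ "range (\<lambda>c x. c)"]) auto

lemma smooth_add:
  assumes "smooth f" "smooth g"
  shows "smooth (\<lambda>x. f x + g x)"
proof -
  have "(\<lambda>x. f x * 1 + g x * 1) \<in> smooth_algebra"
    using smooth_algebra.add[OF smooth_algebra.mult[OF assms(1) smooth_const[of 1]]
        smooth_algebra.mult[OF assms(2) smooth_const[of 1]]] .
  then show ?thesis by (auto dest: smooth_algebra_smooth)
qed

lemma smooth_affine: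
  assumes "smooth f"
  shows "smooth (\<lambda>x. f (c * x + d))"
proof (rule smoothI_deriv_closed[of _ "{\<lambda>x. b * g (c * x + d) | b g. smooth g}"])
  show "(\<lambda>x. f (c * x + d)) \<in> {\<lambda>x. b * g (c * x + d) | b g. smooth g}"
    using assms by (auto intro!: exI[of _ 1])
  have d: "((\<lambda>x. b * g (c * x + d)) has_real_derivative (b * c) * deriv g (c * x + d)) (at x)"
    if "smooth g" for b g x
    by (auto intro!: derivative_eq_intros DERIV_chain'[OF _ smooth_imp_has_deriv[OF that]])
  show "g differentiable (at x)" if "g \<in> {\<lambda>x. b * g (c * x + d) | b g. smooth g}" for g x
    using that d by (auto simp: real_differentiable_def)
  show "deriv g \<in> {\<lambda>x. b * g (c * x + d) | b g. smooth g}"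
    if g: "g \<in> {\<lambda>x. b * g (c * x + d) | b g. smooth g}" for g
  proof -
    from g obtain b h where "smooth h" "g = (\<lambda>x. b * h (c * x + d))" by blast
    then have "deriv g = (\<lambda>x. (b * c) * deriv h (c * x + d))"
      using d[OF \<open>smooth h\<close>] by (auto intro!: ext DERIV_imp_deriv)
    then show ?thesis using smooth_deriv[OF \<open>smooth h\<close>] by blast
  qed
qed

text \<open>
  The derivatives of \<open>exp (- 1 / x)\<close>, extended by zero to the left half-line, all have this form
  with some polynomial \<open>p\<close>; the function itself is \<open>flat 1\<close>.
\<close>

definition flat :: "real poly \<Rightarrow> real \<Rightarrow> real" where
  "flat p x = (if x > 0 then poly p (1 / x) * exp (- (1 / x)) else 0)"

lemma flat_limit: "((\<lambda>x. poly p (1 / x) * exp (- (1 / x))) \<longlongrightarrow> 0) (at_right (0::real))"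
proof -
  have "((\<lambda>y. poly p y * exp (- y)) \<longlongrightarrow> 0) (at_top :: real filter)"
  proof -
    have "((\<lambda>y. (\<Sum>i\<le>degree p. coeff p i * (y ^ i / exp y))) \<longlongrightarrow> (\<Sum>i\<le>degree p. coeff p i * 0))
        (at_top :: real filter)"
      by (intro tendsto_intros tendsto_power_div_exp_0)
    then show ?thesis
      by (simp add: poly_altdef exp_minus field_simps sum_distrib_left sum_divide_distrib)
  qed
  then have "((\<lambda>x. poly p (inverse x) * exp (- inverse x)) \<longlongrightarrow> 0) (at_right (0::real))"
    by (rule filterlim_compose[OF _ filterlim_inverse_at_top_right])
  then show ?thesis by (simp add: inverse_eq_divide)
qed

lemma flat_has_deriv:
  "(flat p has_real_derivative flat ([:0, 0, 1:] * (p - pderiv p)) x) (at x)"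
proof (cases x "0 :: real" rule: linorder_cases)
  case less
  have "((\<lambda>x. 0) has_real_derivative 0) (at x)" by simp
  then have "(flat p has_real_derivative 0) (at x)"
    by (rule DERIV_cong_ev[THEN iffD1, rotated -1])
       (use less in \<open>auto simp: flat_def intro!: eventually_mono[OF eventually_nhds_in_open[of "{..<0}"]]\<close>)
  then show ?thesis using less by (simp add: flat_def)
next
  case greater
  have "((\<lambda>x. poly p (1 / x) * exp (- (1 / x))) has_real_derivative
      poly ([:0, 0, 1:] * (p - pderiv p)) (1 / x) * exp (- (1 / x))) (at x)"
    using greater
    by (auto intro!: derivative_eq_intros DERIV_chain'[OF _ poly_DERIV] simp: field_simps power2_eq_square)
  then have "(flat p has_real_derivative
      poly ([:0, 0, 1:] * (p - pderiv p)) (1 / x) * exp (- (1 / x))) (at x)"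
    by (rule DERIV_cong_ev[THEN iffD1, rotated -1])
       (use greater in \<open>auto simp: flat_def intro!: eventually_mono[OF eventually_nhds_in_open[of "{0<..}"]]\<close>)
  then show ?thesis using greater by (simp add: flat_def)
next
  case equal
  have R: "((\<lambda>h. flat p h / h) \<longlongrightarrow> 0) (at_right 0)"
    using flat_limit[of "[:0, 1:] * p"]
    by (rule Lim_transform_eventually) (auto simp: flat_def eventually_at_filter)
  have L: "((\<lambda>h. flat p h / h) \<longlongrightarrow> 0) (at_left 0)"
    by (rule Lim_transform_eventually[OF tendsto_const]) (auto simp: flat_def eventually_at_filter)
  have "(flat p has_real_derivative 0) (at 0)"
    unfolding DERIV_def using filterlim_split_at[OF L R] by (simp add: flat_def)
  then show ?thesis using equal by (simp add: flat_def)
qed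

lemma smooth_flat: "smooth (flat p)"
proof (rule smoothI_deriv_closed[of _ "range flat"])
  show "g differentiable (at x)" if "g \<in> range flat" for g x
    using that flat_has_deriv by (auto simp: real_differentiable_def)
  show "deriv g \<in> range flat" if "g \<in> range flat" for g
  proof -
    from that obtain p where "g = flat p" by blast
    then have "deriv g = flat ([:0, 0, 1:] * (p - pderiv p))"
      using flat_has_deriv by (blast intro: ext DERIV_imp_deriv)
    then show ?thesis by blast
  qed
qed simp

section \<open>Test functions\<close>

lemma test_function_alt:
  "test_function \<phi> \<longleftrightarrow> smooth \<phi> \<and> (\<exists>R. \<forall>x. \<bar>x\<bar> > R \<longrightarrow> \<phi> x = 0)"
proof -
  have "compact (closure {x. \<phi> x \<noteq> 0}) \<longleftrightarrow> (\<exists>R. \<forall>x. \<bar>x\<bar> > R \<longrightarrow> \<phi> x = 0)"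
    by (simp add: compact_closure bounded_iff) (meson not_le)
  then show ?thesis by (simp add: test_function_def smooth_def)
qed

lemma test_function_supportE:
  assumes "test_function \<phi>"
  obtains R where "R > 0" "\<And>x. \<bar>x\<bar> \<ge> R \<Longrightarrow> \<phi> x = 0" "\<And>x. \<bar>x\<bar> \<ge> R \<Longrightarrow> deriv \<phi> x = 0"
proof -
  obtain R where R: "\<And>x. \<bar>x\<bar> > R \<Longrightarrow> \<phi> x = 0"
    using assms unfolding test_function_alt by blast
  have "deriv \<phi> x = 0" if "\<bar>x\<bar> > R" for x
  proof -
    have "open {x. \<bar>x\<bar> > R}"
      by (intro open_Collect_less continuous_intros)
    then have "\<forall>\<^sub>F y in nhds x. \<bar>y\<bar> > R"
      using eventually_nhds_in_open[of "{x. \<bar>x\<bar> > R}" x] that by simp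
    then have "\<forall>\<^sub>F y in nhds x. \<phi> y = 0"
      by (rule eventually_mono) (use R in auto)
    then have "deriv \<phi> x = deriv (\<lambda>x. 0) x"
      by (rule deriv_cong_ev) simp
    then show ?thesis by simp
  qed
  with R show ?thesis
    by (intro that[of "\<bar>R\<bar> + 1"]) auto
qed

lemma test_function_deriv:
  assumes "test_function \<phi>"
  shows "test_function (deriv \<phi>)"
proof -
  obtain R where "\<And>x. \<bar>x\<bar> \<ge> R \<Longrightarrow> deriv \<phi> x = 0"
    using test_function_supportE[OF assms] by metis
  then show ?thesis
    using assms smooth_deriv by (auto simp: test_function_alt intro!: exI[of _ R])
qed

lemma test_function_add:
  assumes "test_function f" "test_function g"
  shows "test_function (\<lambda>x. f x + g x)"
proof -
  obtain R S where "\<And>x. \<bar>x\<bar> > R \<Longrightarrow> f x = 0" "\<And>x. \<bar>x\<bar> > S \<Longrightarrow> g x = 0"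
    using assms unfolding test_function_alt by blast
  then show ?thesis
    using assms by (auto simp: test_function_alt intro!: exI[of _ "max R S"] smooth_add)
qed

lemma test_function_cmult: "test_function f \<Longrightarrow> test_function (\<lambda>x. c * f x)"
  unfolding test_function_alt using smooth_mult[OF smooth_const] by auto

lemma test_function_bounded:
  assumes "test_function \<phi>"
  obtains B where "\<And>x. \<bar>\<phi> x\<bar> \<le> B"
proof -
  obtain R where R: "R > 0" "\<And>x. \<bar>x\<bar> \<ge> R \<Longrightarrow> \<phi> x = 0"
    using test_function_supportE[OF assms] by metis
  have "continuous_on {-R..R} \<phi>"
    using assms by (auto simp: test_function_alt intro: smooth_imp_continuous_on)
  then obtain B where B: "\<And>x. x \<in> {-R..R} \<Longrightarrow> \<bar>\<phi> x\<bar> \<le> B"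
    using compact_imp_bounded[OF compact_continuous_image[of "{-R..R}" \<phi>]]
    unfolding bounded_iff by (metis compact_Icc image_eqI real_norm_def)
  have "\<bar>\<phi> x\<bar> \<le> \<bar>B\<bar>" for x
  proof (cases "\<bar>x\<bar> \<ge> R")
    case False
    then have "\<bar>\<phi> x\<bar> \<le> B" by (intro B) auto
    then show ?thesis by simp
  qed (use R in simp)
  then show ?thesis by (rule that)
qed

lemma test_function_borel: "test_function \<phi> \<Longrightarrow> \<phi> \<in> borel_measurable borel"
  by (intro borel_measurable_continuous_onI smooth_imp_continuous_on) (simp add: test_function_alt)

text \<open>
  Dilating \<open>flat 1\<close> makes it converge pointwise to the indicator function of the positive half-line
  while it stays between 0 and 1. The product of two such functions is a test function close to the
  indicator of an open interval.
\<close>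

definition plateau :: "real \<Rightarrow> real \<Rightarrow> nat \<Rightarrow> real \<Rightarrow> real" where
  "plateau a b n x = flat 1 (real (Suc n) * (x - a)) * flat 1 (real (Suc n) * (b - x))"

lemma test_function_plateau: "test_function (plateau a b n)"
proof -
  have "smooth (\<lambda>x. flat 1 (real (Suc n) * x + - real (Suc n) * a) * flat 1 (- real (Suc n) * x + real (Suc n) * b))"
    by (intro smooth_mult smooth_affine smooth_flat)
  moreover have "(\<lambda>x. flat 1 (real (Suc n) * x + - real (Suc n) * a) * flat 1 (- real (Suc n) * x + real (Suc n) * b))
      = plateau a b n"
    by (auto simp: plateau_def algebra_simps)
  moreover have "plateau a b n x = 0" if "\<bar>x\<bar> > max \<bar>a\<bar> \<bar>b\<bar>" for x
    using that by (auto simp: plateau_def flat_def zero_less_mult_iff)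
  ultimately show ?thesis
    unfolding test_function_alt by metis
qed

lemma plateau_bounds: "0 \<le> plateau a b n x" "plateau a b n x \<le> indicator {a<..<b} x"
  by (auto simp: plateau_def flat_def zero_less_mult_iff indicator_def intro!: mult_le_one)

lemma plateau_tendsto: "(\<lambda>n. plateau a b n x) \<longlonglongrightarrow> indicator {a<..<b} x"
proof (cases "a < x \<and> x < b")
  case True
  have *: "(\<lambda>n. flat 1 (real (Suc n) * t)) \<longlonglongrightarrow> 1" if "t > 0" for t
  proof -
    have "(\<lambda>n. exp (- (inverse (real (Suc n)) * (1 / t)))) \<longlonglongrightarrow> exp (- (0 * (1 / t)))"
      by (intro tendsto_intros LIMSEQ_inverse_real_of_nat)
    then show ?thesis
      using that by (simp add: flat_def inverse_eq_divide)
  qed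
  show ?thesis
    using tendsto_mult[OF *[of "x - a"] *[of "b - x"]] True
    by (simp add: plateau_def)
next
  case False
  then show ?thesis
    by (auto simp: plateau_def flat_def zero_less_mult_iff)
qed

section \<open>The fundamental lemma of the calculus of variations\<close>

lemma locally_integrable_measurable:
  assumes "locally_integrable h"
  shows "h \<in> borel_measurable lebesgue"
proof (rule borel_measurable_LIMSEQ_real)
  show "(\<lambda>n. indicator {- real n..real n} x * h x) \<longlonglongrightarrow> h x" for x
  proof (rule tendsto_eventually)
    obtain N where "\<bar>x\<bar> \<le> real N" using real_arch_simple by blast
    then show "\<forall>\<^sub>F n in sequentially. indicator {- real n..real n} x * h x = h x"
      by (auto simp: eventually_sequentially indicator_def intro!: exI[of _ N])
  qed
  show "(\<lambda>x. indicator {- real n..real n} x * h x) \<in> borel_measurable lebesgue" for n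
    using assms by (auto simp: locally_integrable_def set_integrable_def)
qed

lemma locally_integrable_mult_bounded_support:
  assumes "locally_integrable h" and "\<psi> \<in> borel_measurable borel"
    and "\<And>x. \<bar>\<psi> x\<bar> \<le> B" and "\<And>x. x \<notin> {a..b} \<Longrightarrow> \<psi> x = 0"
  shows "integrable lebesgue (\<lambda>x. h x * \<psi> x)"
proof (rule Bochner_Integration.integrable_bound)
  show "integrable lebesgue (\<lambda>x. B * (indicator {a..b} x * h x))"
    using assms(1) unfolding locally_integrable_def set_integrable_def by simp
  have "\<psi> \<in> borel_measurable lebesgue"
    using assms(2) by (simp add: borel_measurable_if_I measurable_completion)
  then show "(\<lambda>x. h x * \<psi> x) \<in> borel_measurable lebesgue"
    using locally_integrable_measurable[OF assms(1)] by measurable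
  have "B \<ge> 0" using assms(3)[of 0] by linarith
  have "\<bar>h x * \<psi> x\<bar> \<le> \<bar>B * (indicator {a..b} x * h x)\<bar>" for x
  proof (cases "x \<in> {a..b}")
    case True
    then show ?thesis
      using assms(3)[of x] \<open>B \<ge> 0\<close> mult_right_mono[of "\<bar>\<psi> x\<bar>" B "\<bar>h x\<bar>"]
      by (simp add: abs_mult mult.commute)
  qed (use assms(4) in simp)
  then show "AE x in lebesgue. norm (h x * \<psi> x) \<le> norm (B * (indicator {a..b} x * h x))"
    by simp
qed

lemma integrable_mult_test_function:
  assumes "locally_integrable h" and "test_function \<psi>"
  shows "integrable lebesgue (\<lambda>x. h x * \<psi> x)"
proof -
  obtain B where "\<And>x. \<bar>\<psi> x\<bar> \<le> B" using test_function_bounded[OF assms(2)] by blast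
  moreover obtain R where R: "\<And>x. \<bar>x\<bar> \<ge> R \<Longrightarrow> \<psi> x = 0"
    using test_function_supportE[OF assms(2)] by metis
  moreover have "\<psi> x = 0" if "x \<notin> {-R..R}" for x using that by (intro R) auto
  ultimately show ?thesis
    using locally_integrable_mult_bounded_support[OF assms(1) test_function_borel[OF assms(2)]] by blast
qed

text \<open>
  Open intervals are an intersection-stable generator of the Borel sets, and every Lebesgue set
  differs from a Borel set by a null set; so all set integrals vanish.
\<close>

lemma AE_zero_if_interval_integrals_zero:
  fixes h :: "real \<Rightarrow> real"
  assumes int: "integrable lebesgue h"
    and zero: "\<And>a b. (\<integral>x. indicator {a<..<b} x * h x \<partial>lebesgue) = 0"
    and total: "(\<integral>x. h x \<partial>lebesgue) = 0"
  shows "AE x in lebesgue. h x = 0"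
proof (rule density_unique_real[where f' = "\<lambda>x. 0"])
  have si: "set_integrable lebesgue A h" if "A \<in> sets lebesgue" for A
    using integrable_mult_indicator[OF that int] by (simp add: set_integrable_def)
  have G: "sets borel = sigma_sets UNIV (range (\<lambda>(a, b). {a<..<b :: real}))"
    by (subst borel_eq_box) (simp add: split_beta')
  have borel: "(LINT x:A|lebesgue. h x) = 0" if "A \<in> sets borel" for A
  proof -
    have "Int_stable (range (\<lambda>(a, b). {a<..<b :: real}))"
      by (auto simp: Int_stable_def)
    moreover have "range (\<lambda>(a, b). {a<..<b :: real}) \<subseteq> Pow UNIV" by simp
    moreover have "A \<in> sigma_sets UNIV (range (\<lambda>(a, b). {a<..<b :: real}))"
      using that by (simp add: G)
    ultimately show ?thesis
    proof (induction rule: sigma_sets_induct_disjoint)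
      case (basic A)
      then show ?case using zero by (auto simp: set_lebesgue_integral_def)
    next
      case empty
      show ?case by (simp add: set_lebesgue_integral_def)
    next
      case (compl A)
      then have "A \<in> sets borel" by (simp add: G)
      then have A: "A \<in> sets lebesgue" "UNIV - A \<in> sets lebesgue" by auto
      have "(LINT x:A \<union> (UNIV - A)|lebesgue. h x)
          = (LINT x:A|lebesgue. h x) + (LINT x:UNIV - A|lebesgue. h x)"
        using A by (intro set_integral_Un si) auto
      moreover have "(LINT x:A \<union> (UNIV - A)|lebesgue. h x) = 0"
        using total by (simp add: set_lebesgue_integral_def)
      ultimately show ?case using compl by simp
    next
      case (union A)
      then have "A i \<in> sets borel" for i by (auto simp: G)
      then have A: "A i \<in> sets lebesgue" for i by auto
      have "(LINT x:(\<Union>i. A i)|lebesgue. h x) = (\<Sum>i. (LINT x:(A i)|lebesgue. h x))"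
        using union(1) by (intro lebesgue_integral_countable_add si A sets.countable_UN)
          (auto simp: disjoint_family_on_def A)
      with union show ?case by simp
    qed
  qed
  show "(LINT x:A|lebesgue. h x) = (LINT x:A|lebesgue. 0)" if "A \<in> sets lebesgue" for A
  proof -
    from that obtain S N N' where S: "A = S \<union> N" "N \<subseteq> N'" "N' \<in> null_sets lborel" "S \<in> sets lborel"
      by (rule sets_completionE)
    have "AE x in lebesgue. x \<notin> N'"
      using S(3) by (intro AE_not_in null_sets_completionI)
    then have "AE x in lebesgue. indicator A x *\<^sub>R h x = indicator S x *\<^sub>R h x"
      using S by (auto simp: indicator_def elim!: eventually_mono)
    moreover have "S \<in> sets lebesgue" using S by auto
    ultimately have "(LINT x:A|lebesgue. h x) = (LINT x:S|lebesgue. h x)"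
      unfolding set_lebesgue_integral_def using si[of A] si[of S] that
      by (intro integral_cong_AE) (auto simp: set_integrable_def)
    then show ?thesis using borel[of S] S by simp
  qed
qed (use int in simp_all)

text \<open>
  Testing with \<open>plateau\<close> and passing to the limit shows that the integral over every bounded open
  interval vanishes.
\<close>

lemma AE_zero_if_orthogonal_to_test_functions:
  assumes h: "locally_integrable h"
    and zero: "\<And>\<phi>. test_function \<phi> \<Longrightarrow> (\<integral>x. h x * \<phi> x \<partial>lebesgue) = 0"
  shows "AE x in lebesgue. h x = 0"
proof -
  have meas: "h \<in> borel_measurable lebesgue"
    using h by (rule locally_integrable_measurable)
  have intv: "(\<integral>x. h x * indicator {a<..<b} x \<partial>lebesgue) = 0" for a b
  proof -
    have "(\<lambda>n. \<integral>x. h x * plateau a b n x \<partial>lebesgue) \<longlonglongrightarrow> (\<integral>x. h x * indicator {a<..<b} x \<partial>lebesgue)"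
    proof (rule integral_dominated_convergence[where w = "\<lambda>x. \<bar>indicator {a..b} x * h x\<bar>"])
      show "integrable lebesgue (\<lambda>x. \<bar>indicator {a..b} x * h x\<bar>)"
        using h unfolding locally_integrable_def set_integrable_def by (intro integrable_abs) simp
      show "AE x in lebesgue. (\<lambda>n. h x * plateau a b n x) \<longlonglongrightarrow> h x * indicator {a<..<b} x"
        by (intro AE_I2 tendsto_intros plateau_tendsto)
      show "AE x in lebesgue. norm (h x * plateau a b n x) \<le> \<bar>indicator {a..b} x * h x\<bar>" for n
      proof (rule AE_I2)
        fix x
        show "norm (h x * plateau a b n x) \<le> \<bar>indicator {a..b} x * h x\<bar>"
          using plateau_bounds[of a b n x] mult_left_le[of "plateau a b n x" "\<bar>h x\<bar>"]
          by (cases "a < x \<and> x < b") (auto simp: abs_mult indicator_def split: if_splits)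
      qed
      show "(\<lambda>x. h x * plateau a b n x) \<in> borel_measurable lebesgue" for n
        using integrable_mult_test_function[OF h test_function_plateau] by blast
      show "(\<lambda>x. h x * indicator {a<..<b} x) \<in> borel_measurable lebesgue"
        by (intro borel_measurable_times meas) (simp add: measurable_completion)
    qed
    moreover have "(\<integral>x. h x * plateau a b n x \<partial>lebesgue) = 0" for n
      by (intro zero test_function_plateau)
    ultimately show ?thesis by (simp add: LIMSEQ_const_iff)
  qed
  have "AE x in lebesgue. h x * indicator {- real n<..<real n} x = 0" for n :: nat
  proof (rule AE_zero_if_interval_integrals_zero)
    show "integrable lebesgue (\<lambda>x. h x * indicator {- real n<..<real n} x)"
      by (rule locally_integrable_mult_bounded_support[OF h, of _ 1 "- real n" "real n"]) auto
    show "(\<integral>x. indicator {a<..<b} x * (h x * indicator {- real n<..<real n} x) \<partial>lebesgue) = 0" for a b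
    proof -
      have "indicator {a<..<b} x * (h x * indicator {- real n<..<real n} x)
          = h x * indicator {max a (- real n)<..<min b (real n)} x" for x
        by (auto simp: indicator_def)
      then show ?thesis using intv by presburger
    qed
    show "(\<integral>x. h x * indicator {- real n<..<real n} x \<partial>lebesgue) = 0" by (rule intv)
  qed
  then have "AE x in lebesgue. \<forall>n::nat. h x * indicator {- real n<..<real n} x = 0"
    by (subst AE_all_countable) blast
  then show ?thesis
  proof (rule eventually_mono)
    fix x assume *: "\<forall>n::nat. h x * indicator {- real n<..<real n} x = 0"
    obtain n :: nat where "\<bar>x\<bar> < real n" using reals_Archimedean2 by blast
    then show "h x = 0" using *[rule_format, of n] by (auto simp: indicator_def split: if_splits)
  qed
qed

section \<open>Weak derivatives in one variable\<close>

lemma locally_integrable_diff: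
  "locally_integrable f \<Longrightarrow> locally_integrable g \<Longrightarrow> locally_integrable (\<lambda>x. f x - g x)"
  unfolding locally_integrable_def by (auto intro: set_integral_diff)

lemma locally_integrable_continuous:
  assumes "continuous_on UNIV f"
  shows "locally_integrable f"
proof -
  have "set_integrable lborel {a..b} f" for a b
    by (intro borel_integrable_atLeastAtMost' continuous_on_subset[OF assms]) simp
  then show ?thesis
    unfolding locally_integrable_def set_integrable_def
    by (auto simp: integrable_completion)
qed

lemma weak_deriv_unique:
  assumes "has_weak_deriv f g" "has_weak_deriv f h"
  shows "AE x in lebesgue. g x = h x"
proof -
  have "AE x in lebesgue. g x - h x = 0"
  proof (rule AE_zero_if_orthogonal_to_test_functions)
    show "locally_integrable (\<lambda>x. g x - h x)"
      using assms by (auto simp: has_weak_deriv_def intro: locally_integrable_diff)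
    fix \<phi> assume "test_function \<phi>"
    moreover from this have "integrable lebesgue (\<lambda>x. g x * \<phi> x)" "integrable lebesgue (\<lambda>x. h x * \<phi> x)"
      using assms by (auto simp: has_weak_deriv_def intro: integrable_mult_test_function)
    ultimately show "(\<integral>x. (g x - h x) * \<phi> x \<partial>lebesgue) = 0"
      using assms by (simp add: has_weak_deriv_def left_diff_distrib)
  qed
  then show ?thesis by simp
qed

lemma has_weak_deriv_cong_AE:
  assumes "has_weak_deriv f g"
    and "AE x in lebesgue. f x = f' x" "f' \<in> borel_measurable lebesgue"
    and "AE x in lebesgue. g x = g' x" "g' \<in> borel_measurable lebesgue"
  shows "has_weak_deriv f' g'"
proof -
  have li: "locally_integrable k'"
    if "locally_integrable k" "AE x in lebesgue. k x = k' x" "k' \<in> borel_measurable lebesgue" for k k'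
    unfolding locally_integrable_def set_integrable_def
  proof (intro allI)
    fix a b :: real
    have "integrable lebesgue (\<lambda>x. indicator {a..b} x *\<^sub>R k x)"
      using that(1) unfolding locally_integrable_def set_integrable_def by blast
    moreover have "(\<lambda>x. indicator {a..b} x *\<^sub>R k' x) \<in> borel_measurable lebesgue"
      by (intro borel_measurable_scaleR that(3)) (simp add: measurable_completion)
    moreover have "AE x in lebesgue. indicator {a..b} x *\<^sub>R k x = indicator {a..b} x *\<^sub>R k' x"
      using that(2) by (rule eventually_mono) simp
    ultimately show "integrable lebesgue (\<lambda>x. indicator {a..b} x *\<^sub>R k' x)"
      by (rule integrable_cong_AE_imp)
  qed
  have eq: "(\<integral>x. k' x * \<psi> x \<partial>lebesgue) = (\<integral>x. k x * \<psi> x \<partial>lebesgue)"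
    if "locally_integrable k" "AE x in lebesgue. k x = k' x" "k' \<in> borel_measurable lebesgue"
      "test_function \<psi>" for k k' \<psi>
  proof (rule integral_cong_AE)
    have "\<psi> \<in> borel_measurable lebesgue"
      using test_function_borel[OF that(4)] by (simp add: measurable_completion)
    then show "(\<lambda>x. k' x * \<psi> x) \<in> borel_measurable lebesgue" "(\<lambda>x. k x * \<psi> x) \<in> borel_measurable lebesgue"
      using that(3) locally_integrable_measurable[OF that(1)] by measurable
  qed (use that in \<open>auto elim!: eventually_mono\<close>)
  show ?thesis
    using assms li eq[of f f'] eq[of g g'] test_function_deriv
    unfolding has_weak_deriv_def by metis
qed

text \<open>
  The inner integral when the order of integration is exchanged in \<open>Fubini_deriv_test_function\<close>.
\<close>

lemma integral_deriv_test_function_tail: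
  assumes "test_function \<phi>"
  shows "(\<integral>x. indicator {y..} x * deriv \<phi> x \<partial>lborel) = - \<phi> y"
proof -
  obtain R where R: "\<And>x. \<bar>x\<bar> \<ge> R \<Longrightarrow> \<phi> x = 0" "\<And>x. \<bar>x\<bar> \<ge> R \<Longrightarrow> deriv \<phi> x = 0"
    using test_function_supportE[OF assms] by metis
  define b where "b = max y \<bar>R\<bar>"
  have b: "y \<le> b" "R \<le> b" "b \<ge> 0" by (auto simp: b_def)
  have smooth: "smooth \<phi>" using assms by (simp add: test_function_alt)
  have "(\<integral>x. deriv \<phi> x * indicator {y..b} x \<partial>lborel) = \<phi> b - \<phi> y"
    by (rule integral_FTC_Icc_real[OF b(1) smooth_imp_has_deriv[OF smooth]])
       (meson continuous_on_eq_continuous_at open_UNIV UNIV_I smooth smooth_deriv smooth_imp_continuous_on)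
  moreover have "deriv \<phi> x * indicator {y..b} x = indicator {y..} x * deriv \<phi> x" for x
    using R(2)[of x] b by (auto simp: indicator_def)
  moreover have "\<phi> b = 0" using R(1)[of b] b by auto
  ultimately show ?thesis by simp
qed

text \<open>
  The mean-zero condition is what makes the antiderivative vanish on both sides of the support.
\<close>

lemma test_function_antideriv:
  assumes \<theta>: "test_function \<theta>" and zero: "(\<integral>x. \<theta> x \<partial>lborel) = 0"
  obtains \<phi> where "test_function \<phi>" "deriv \<phi> = \<theta>"
proof -
  obtain R where R: "R > 0" "\<And>x. \<bar>x\<bar> \<ge> R \<Longrightarrow> \<theta> x = 0"
    using test_function_supportE[OF \<theta>] by metis
  have smooth: "smooth \<theta>" using \<theta> by (simp add: test_function_alt)
  define \<phi> where "\<phi> x = - (\<integral>y. indicator {x..} y * \<theta> y \<partial>lborel)" for x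
  have cont: "isCont \<theta> x" for x
    by (rule DERIV_isCont[OF smooth_imp_has_deriv[OF smooth]])
  have fin: "\<phi> x = - (\<integral>y. \<theta> y * indicator {x..b} y \<partial>lborel)" if "b \<ge> R" for x b
    unfolding \<phi>_def
    by (rule arg_cong[where f = uminus], rule Bochner_Integration.integral_cong)
       (use that R in \<open>auto simp: indicator_def\<close>)
  have int: "integrable lborel (\<lambda>y. \<theta> y * indicator {a..b} y)" for a b
    using borel_integrable_atLeastAtMost'[of a b \<theta>] smooth_imp_continuous_on[OF smooth]
    by (simp add: set_integrable_def mult.commute)
  have der: "(\<phi> has_real_derivative \<theta> x) (at x)" for x
  proof -
    define a b where "a = min x 0 - 1" and "b = max x R + 1"
    have x: "a < x" "x < b" and b: "b \<ge> R" by (auto simp: a_def b_def)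
    have "((\<lambda>u. LBINT y=b..u. \<theta> y) has_vector_derivative \<theta> x) (at x within {a..b})"
      using x by (intro interval_integral_FTC2 smooth_imp_continuous_on smooth) auto
    then have "((\<lambda>u. LBINT y=b..u. \<theta> y) has_real_derivative \<theta> x) (at x)"
      using x at_within_Icc_at[of a x b]
      by (simp add: has_real_derivative_iff_has_vector_derivative)
    moreover have "\<forall>\<^sub>F u in nhds x. (LBINT y=b..u. \<theta> y) = \<phi> u"
    proof (rule eventually_mono[OF eventually_nhds_in_open[of "{..<b}"]])
      fix u assume "u \<in> {..<b}"
      then have "(LBINT y=u..b. \<theta> y) = (\<integral>y. \<theta> y * indicator {u..b} y \<partial>lborel)"
        by (simp add: interval_integral_Icc set_lebesgue_integral_def mult.commute)
      moreover have "(LBINT y=b..u. \<theta> y) = - (LBINT y=u..b. \<theta> y)"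
        by (rule interval_integral_endpoints_reverse)
      ultimately show "(LBINT y=b..u. \<theta> y) = \<phi> u"
        using fin[OF b] by simp
    qed (use x in auto)
    ultimately show ?thesis
      by (subst DERIV_cong_ev[where g = "\<lambda>u. LBINT y=b..u. \<theta> y"]) (auto elim: eventually_mono)
  qed
  have "\<phi> x = 0" if "\<bar>x\<bar> > R" for x
  proof (cases "x > R")
    case True
    then have "(\<lambda>y. indicator {x..} y * \<theta> y) = (\<lambda>y. 0)"
      using R by (auto simp: indicator_def)
    then show ?thesis by (simp add: \<phi>_def)
  next
    case False
    then have "(\<lambda>y. indicator {x..} y * \<theta> y) = \<theta>"
      using R(2) that by (force simp: indicator_def fun_eq_iff)
    then show ?thesis using zero by (simp add: \<phi>_def)
  qed
  then have "test_function \<phi>"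
    using smooth_antideriv[OF der smooth] by (auto simp: test_function_alt intro!: exI[of _ R])
  moreover have "deriv \<phi> = \<theta>"
    using der by (auto intro: DERIV_imp_deriv)
  ultimately show ?thesis by (rule that)
qed

text \<open>
  Subtracting a multiple of a fixed test function turns any test function into one of mean zero,
  that is, into a derivative. Hence \<open>h\<close> integrates against test functions like a constant.
\<close>

lemma AE_const_if_orthogonal_to_derivs:
  assumes h: "locally_integrable h"
    and zero: "\<And>\<phi>. test_function \<phi> \<Longrightarrow> (\<integral>x. h x * deriv \<phi> x \<partial>lebesgue) = 0"
  obtains c where "AE x in lebesgue. h x = c"
proof -
  define \<psi>\<^sub>0 where "\<psi>\<^sub>0 = plateau 0 1 0"
  have \<psi>\<^sub>0: "test_function \<psi>\<^sub>0" by (simp add: \<psi>\<^sub>0_def test_function_plateau)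
  have one: "locally_integrable (\<lambda>x. 1)"
    by (intro locally_integrable_continuous) simp
  have int: "integrable lborel \<psi>" if "test_function \<psi>" for \<psi>
    using integrable_mult_test_function[OF one that] test_function_borel[OF that]
    by (simp add: integrable_completion)
  define I where "I = (\<integral>x. \<psi>\<^sub>0 x \<partial>lborel)"
  have "I \<noteq> 0"
  proof
    assume "I = 0"
    then have "AE x in lborel. \<psi>\<^sub>0 x = 0"
      unfolding I_def using int[OF \<psi>\<^sub>0] plateau_bounds(1)
      by (subst (asm) integral_nonneg_eq_0_iff_AE) (auto simp: \<psi>\<^sub>0_def)
    moreover have "\<psi>\<^sub>0 x \<noteq> 0" if "x \<in> {0<..<1}" for x
      using that by (simp add: \<psi>\<^sub>0_def plateau_def flat_def)
    ultimately have "AE x in lborel. x \<notin> {0<..<1::real}"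
      by (auto elim: eventually_mono)
    then have "emeasure lborel {0<..<1::real} = 0"
      by (subst (asm) AE_iff_measurable[of "{0<..<1::real}"]) auto
    then show False by simp
  qed
  define c where "c = (\<integral>x. h x * \<psi>\<^sub>0 x \<partial>lebesgue) / I"
  have "AE x in lebesgue. h x - c = 0"
  proof (rule AE_zero_if_orthogonal_to_test_functions)
    show "locally_integrable (\<lambda>x. h x - c)"
      by (intro locally_integrable_diff h locally_integrable_continuous) simp
    fix \<psi> assume \<psi>: "test_function \<psi>"
    define r where "r = (\<integral>x. \<psi> x \<partial>lborel) / I"
    have \<theta>: "test_function (\<lambda>x. \<psi> x + (- r) * \<psi>\<^sub>0 x)"
      by (intro test_function_add test_function_cmult \<psi> \<psi>\<^sub>0)
    have "(\<integral>x. \<psi> x + (- r) * \<psi>\<^sub>0 x \<partial>lborel) = 0"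
      using int[OF \<psi>] int[OF \<psi>\<^sub>0] \<open>I \<noteq> 0\<close> by (simp add: r_def flip: I_def)
    then obtain \<phi> where "test_function \<phi>" "deriv \<phi> = (\<lambda>x. \<psi> x + (- r) * \<psi>\<^sub>0 x)"
      using test_function_antideriv[OF \<theta>] by blast
    with zero have "(\<integral>x. h x * (\<psi> x + (- r) * \<psi>\<^sub>0 x) \<partial>lebesgue) = 0" by metis
    moreover have ih: "integrable lebesgue (\<lambda>x. h x * \<psi> x)" "integrable lebesgue (\<lambda>x. h x * \<psi>\<^sub>0 x)"
      using integrable_mult_test_function[OF h] \<psi> \<psi>\<^sub>0 by auto
    moreover have "h x * (\<psi> x + (- r) * \<psi>\<^sub>0 x) = h x * \<psi> x - r * (h x * \<psi>\<^sub>0 x)" for x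
      by (simp add: algebra_simps)
    ultimately have "(\<integral>x. h x * \<psi> x \<partial>lebesgue) = r * (\<integral>x. h x * \<psi>\<^sub>0 x \<partial>lebesgue)"
      by simp
    also have "\<dots> = c * (\<integral>x. \<psi> x \<partial>lborel)"
      by (simp add: r_def c_def)
    also have "(\<integral>x. \<psi> x \<partial>lborel) = (\<integral>x. \<psi> x \<partial>lebesgue)"
      using test_function_borel[OF \<psi>] by (simp add: integral_completion)
    finally show "(\<integral>x. (h x - c) * \<psi> x \<partial>lebesgue) = 0"
      using ih(1) integrable_mult_test_function[OF one \<psi>]
      by (simp add: left_diff_distrib)
  qed
  then show ?thesis by (intro that[of c]) simp
qed

text \<open>
  Integration by parts for a primitive of a merely integrable function \<open>g\<close>, where the product rule
  is not available.
\<close>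

lemma Fubini_deriv_test_function:
  fixes g :: "real \<Rightarrow> real"
  assumes \<phi>: "test_function \<phi>" and R: "\<And>x. \<bar>x\<bar> \<ge> R \<Longrightarrow> \<phi> x = 0" "\<And>x. \<bar>x\<bar> \<ge> R \<Longrightarrow> deriv \<phi> x = 0"
    and g: "integrable lborel (\<lambda>y. indicator {-R..R} y * g y)"
  shows "(\<integral>x. (\<integral>y. indicator {-R<..x} y * g y \<partial>lborel) * deriv \<phi> x \<partial>lborel)
    = - (\<integral>y. g y * \<phi> y \<partial>lborel)"
proof -
  define G where "G y = indicator {-R..R} y * g y" for y
  have [measurable]: "G \<in> borel_measurable borel"
    using g by (simp add: G_def[abs_def])
  have [measurable]: "deriv \<phi> \<in> borel_measurable borel"
    by (intro test_function_borel test_function_deriv \<phi>)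
  have G: "integrable lborel G" using g by (simp add: G_def[abs_def])
  have D: "integrable lborel (deriv \<phi>)"
    using integrable_mult_test_function[of "\<lambda>x. 1", OF locally_integrable_continuous test_function_deriv[OF \<phi>]]
    by (simp add: integrable_completion)
  define k where "k x y = (if y \<le> x then G y * deriv \<phi> x else 0)" for x y
  have km[measurable]: "case_prod k \<in> borel_measurable (lborel \<Otimes>\<^sub>M lborel)"
    unfolding k_def[abs_def] by measurable
  have "integrable (lborel \<Otimes>\<^sub>M lborel) (\<lambda>(x, y). G y * deriv \<phi> x)"
  proof (rule lborel_pair.Fubini_integrable)
    show "integrable lborel (\<lambda>x. \<integral>y. norm (case (x, y) of (x, y) \<Rightarrow> G y * deriv \<phi> x) \<partial>lborel)"
      using D by (simp add: abs_mult)
    show "AE x in lborel. integrable lborel (\<lambda>y. case (x, y) of (x, y) \<Rightarrow> G y * deriv \<phi> x)"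
      using G by simp
  qed measurable
  then have "integrable (lborel \<Otimes>\<^sub>M lborel) (case_prod k)"
    by (rule Bochner_Integration.integrable_bound[OF _ km]) (auto simp: k_def)
  from lborel_pair.Fubini_integral[OF this]
  have swap: "(\<integral>x. (\<integral>y. k x y \<partial>lborel) \<partial>lborel) = (\<integral>y. (\<integral>x. k x y \<partial>lborel) \<partial>lborel)" by simp
  have inner_x: "(\<integral>x. k x y \<partial>lborel) = - (g y * \<phi> y)" for y
  proof -
    have "(\<integral>x. k x y \<partial>lborel) = (\<integral>x. G y * (indicator {y..} x * deriv \<phi> x) \<partial>lborel)"
      by (rule Bochner_Integration.integral_cong) (auto simp: k_def indicator_def)
    also have "\<dots> = G y * (- \<phi> y)"
      by (simp add: integral_deriv_test_function_tail[OF \<phi>])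
    also have "\<dots> = - (g y * \<phi> y)"
      using R(1)[of y] by (cases "\<bar>y\<bar> \<ge> R") (auto simp: G_def indicator_def)
    finally show ?thesis .
  qed
  have inner_y: "(\<integral>y. k x y \<partial>lborel) = (\<integral>y. indicator {-R<..x} y * g y \<partial>lborel) * deriv \<phi> x" for x
  proof (cases "\<bar>x\<bar> \<ge> R")
    case True
    then have "k x = (\<lambda>y. 0)" using R(2)[of x] by (auto simp: k_def)
    then show ?thesis using True R(2)[of x] by simp
  next
    case False
    have "AE y in lborel. y \<noteq> - R" by (rule AE_lborel_singleton)
    have "(\<integral>y. k x y \<partial>lborel) = (\<integral>y. indicator {-R<..x} y * g y * deriv \<phi> x \<partial>lborel)"
    proof (rule integral_cong_AE)
      show "AE y in lborel. k x y = indicator {-R<..x} y * g y * deriv \<phi> x"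
        using \<open>AE y in lborel. y \<noteq> - R\<close>
        by (rule eventually_mono) (use False in \<open>auto simp: k_def G_def indicator_def\<close>)
      have "(\<lambda>y. indicator {-R<..x} y * G y * deriv \<phi> x) \<in> borel_measurable lborel"
        by measurable
      moreover have "indicator {-R<..x} y * G y = indicator {-R<..x} y * g y" for y
        using False by (auto simp: G_def indicator_def)
      ultimately show "(\<lambda>y. indicator {-R<..x} y * g y * deriv \<phi> x) \<in> borel_measurable lborel"
        by simp
    qed measurable
    then show ?thesis by simp
  qed
  show ?thesis using swap by (simp add: inner_x inner_y)
qed

text \<open>
  The primitive \<open>F\<close> of the weak derivative is continuous and has the same weak derivative as \<open>f\<close>, so
  that \<open>f - F\<close> is constant almost everywhere.
\<close>

lemma has_weak_deriv_imp_continuous: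
  assumes "has_weak_deriv f g"
  obtains F where "continuous_on UNIV F" "AE x in lebesgue. f x = F x"
proof -
  have fg: "locally_integrable f" "locally_integrable g"
    and wd: "\<And>\<phi>. test_function \<phi> \<Longrightarrow>
      (\<integral>x. f x * deriv \<phi> x \<partial>lebesgue) = - (\<integral>x. g x * \<phi> x \<partial>lebesgue)"
    using assms by (auto simp: has_weak_deriv_def)
  obtain h where h[measurable]: "h \<in> borel_measurable lborel" and gh: "AE x in lborel. g x = h x"
    using completion_ex_borel_measurable_real[OF locally_integrable_measurable[OF fg(2)]] by blast
  have gh': "AE x in lebesgue. g x = h x" using gh by (rule AE_completion)
  have hint: "integrable lborel (\<lambda>y. indicator {a..b} y * h y)" for a b
  proof -
    have "integrable lebesgue (\<lambda>y. indicator {a..b} y * h y)"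
    proof (rule integrable_cong_AE_imp)
      show "integrable lebesgue (\<lambda>y. indicator {a..b} y * g y)"
        using fg(2) by (simp add: locally_integrable_def set_integrable_def)
      show "(\<lambda>y. indicator {a..b} y * h y) \<in> borel_measurable lebesgue"
        by (intro measurable_completion) measurable
    qed (use gh' in \<open>auto elim!: eventually_mono\<close>)
    then show ?thesis by (subst (asm) integrable_completion) measurable
  qed
  \<comment> \<open>The signed indicator of the interval between 0 and \<open>x\<close>, so that one integral represents
    the primitive on both half-lines.\<close>
  define s where "s x y = (if 0 < y \<and> y \<le> x then 1 else 0) - (if x < y \<and> y \<le> 0 then 1 else (0::real))" for x y :: real
  define F where "F x = (\<integral>y. s x y * h y \<partial>lborel)" for x
  have sint: "integrable lborel (\<lambda>y. s x y * h y)" for x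
    by (rule Bochner_Integration.integrable_bound[OF hint[of "- \<bar>x\<bar>" "\<bar>x\<bar>"]])
       (auto simp: s_def indicator_def)
  have "isCont F x" for x
  proof (rule continuous_at_sequentiallyI)
    fix u assume u: "u \<longlonglongrightarrow> x"
    then obtain R where R: "\<And>n. \<bar>u n\<bar> \<le> R"
      using convergent_imp_Bseq[of u] by (auto simp: convergent_def Bseq_def)
    show "(\<lambda>n. F (u n)) \<longlonglongrightarrow> F x"
      unfolding F_def
    proof (rule integral_dominated_convergence[where w = "\<lambda>y. \<bar>indicator {-R..R} y * h y\<bar>"])
      show "integrable lborel (\<lambda>y. \<bar>indicator {-R..R} y * h y\<bar>)"
        by (intro integrable_abs hint)
      have "(\<lambda>n. s (u n) y * h y) \<longlonglongrightarrow> s x y * h y" if "y \<noteq> x" for y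
      proof (rule tendsto_eventually)
        have "\<forall>\<^sub>F n in sequentially. (y \<le> u n) = (y \<le> x)"
        proof (cases "y < x")
          case True
          then show ?thesis using order_tendstoD(1)[OF u True] by (auto elim: eventually_mono)
        next
          case False
          then have "x < y" using that by simp
          then show ?thesis using order_tendstoD(2)[OF u \<open>x < y\<close>] by (auto elim: eventually_mono)
        qed
        then show "\<forall>\<^sub>F n in sequentially. s (u n) y * h y = s x y * h y"
          by (rule eventually_mono) (auto simp: s_def not_less[symmetric])
      qed
      then show "AE y in lborel. (\<lambda>n. s (u n) y * h y) \<longlonglongrightarrow> s x y * h y"
        by (auto intro: eventually_mono[OF AE_lborel_singleton[of x]])
      have "\<bar>s (u n) y * h y\<bar> \<le> \<bar>indicator {-R..R} y * h y\<bar>" for n y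
        using R[of n] by (auto simp: s_def indicator_def abs_le_iff)
      then show "AE y in lborel. norm (s (u n) y * h y) \<le> \<bar>indicator {-R..R} y * h y\<bar>" for n
        by simp
    qed (use sint in blast)+
  qed
  then have cont: "continuous_on UNIV F"
    by (simp add: continuous_on_eq_continuous_at)
  have li: "locally_integrable (\<lambda>x. f x - F x)"
    by (intro locally_integrable_diff fg locally_integrable_continuous cont)
  obtain c where "AE x in lebesgue. f x - F x = c"
  proof (rule AE_const_if_orthogonal_to_derivs[OF li])
    fix \<phi> assume \<phi>: "test_function \<phi>"
    then obtain R where R: "R > 0" "\<And>x. \<bar>x\<bar> \<ge> R \<Longrightarrow> \<phi> x = 0" "\<And>x. \<bar>x\<bar> \<ge> R \<Longrightarrow> deriv \<phi> x = 0"
      using test_function_supportE by metis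
    note \<phi>' = test_function_deriv[OF \<phi>]
    have [measurable]: "\<phi> \<in> borel_measurable borel" "deriv \<phi> \<in> borel_measurable borel" "F \<in> borel_measurable borel"
      using test_function_borel \<phi> \<phi>' cont by (auto intro: borel_measurable_continuous_onI)
    have intF: "integrable lebesgue (\<lambda>x. F x * deriv \<phi> x)"
      by (intro integrable_mult_test_function locally_integrable_continuous cont \<phi>')
    have split: "F x * deriv \<phi> x
        = F (- R) * deriv \<phi> x + (\<integral>y. indicator {-R<..x} y * h y \<partial>lborel) * deriv \<phi> x" for x
    proof (cases "x \<ge> - R")
      case True
      have "F x - F (- R) = (\<integral>y. s x y * h y - s (- R) y * h y \<partial>lborel)"
        unfolding F_def using sint by simp
      also have "\<dots> = (\<integral>y. indicator {-R<..x} y * h y \<partial>lborel)"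
        by (rule Bochner_Integration.integral_cong) (use True R(1) in \<open>auto simp: s_def indicator_def\<close>)
      finally have "F x = F (- R) + (\<integral>y. indicator {-R<..x} y * h y \<partial>lborel)" by simp
      then show ?thesis by (simp add: algebra_simps)
    next
      case False
      then show ?thesis using R(3)[of x] by simp
    qed
    have "(\<integral>x. F x * deriv \<phi> x \<partial>lebesgue) = (\<integral>x. F x * deriv \<phi> x \<partial>lborel)"
      by (intro integral_completion) measurable
    also have "\<dots> = (\<integral>x. F (- R) * deriv \<phi> x + (\<integral>y. indicator {-R<..x} y * h y \<partial>lborel) * deriv \<phi> x \<partial>lborel)"
      using split by simp
    also have "\<dots> = - (\<integral>y. h y * \<phi> y \<partial>lborel)"
    proof -
      have "integrable lebesgue (\<lambda>x. 1 * deriv \<phi> x)"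
        by (intro integrable_mult_test_function locally_integrable_continuous \<phi>') simp
      then have D: "integrable lborel (deriv \<phi>)" by (simp add: integrable_completion)
      have "(\<lambda>x. indicator {- R..} x * deriv \<phi> x) = deriv \<phi>"
        using R(1,3) by (force simp: indicator_def fun_eq_iff)
      then have Z: "(\<integral>x. deriv \<phi> x \<partial>lborel) = 0"
        using integral_deriv_test_function_tail[OF \<phi>, of "- R"] R(1,2) by simp
      have "integrable lborel (\<lambda>x. F x * deriv \<phi> x)"
        using intF by (subst (asm) integrable_completion) measurable
      then have "integrable lborel (\<lambda>x. F x * deriv \<phi> x - F (- R) * deriv \<phi> x)"
        using D by simp
      moreover have "F x * deriv \<phi> x - F (- R) * deriv \<phi> x
          = (\<integral>y. indicator {-R<..x} y * h y \<partial>lborel) * deriv \<phi> x" for x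
        using split[of x] by simp
      ultimately have "integrable lborel (\<lambda>x. (\<integral>y. indicator {-R<..x} y * h y \<partial>lborel) * deriv \<phi> x)"
        by simp
      with D show ?thesis
        using Z Fubini_deriv_test_function[OF \<phi> R(2,3) hint] by simp
    qed
    also have "(\<integral>y. h y * \<phi> y \<partial>lborel) = (\<integral>y. h y * \<phi> y \<partial>lebesgue)"
      by (intro integral_completion[symmetric]) measurable
    also have "\<dots> = (\<integral>y. g y * \<phi> y \<partial>lebesgue)"
    proof (rule integral_cong_AE)
      show "(\<lambda>y. h y * \<phi> y) \<in> borel_measurable lebesgue"
        by (intro measurable_completion) measurable
      show "(\<lambda>y. g y * \<phi> y) \<in> borel_measurable lebesgue"
        using integrable_mult_test_function[OF fg(2) \<phi>] by blast
    qed (use gh' in \<open>auto elim!: eventually_mono\<close>)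
    finally show "(\<integral>x. (f x - F x) * deriv \<phi> x \<partial>lebesgue) = 0"
      using wd[OF \<phi>] intF integrable_mult_test_function[OF fg(1) \<phi>']
      by (simp add: left_diff_distrib)
  qed
  then show ?thesis
    by (intro that[of "\<lambda>x. F x + c"] continuous_intros cont) (auto elim!: eventually_mono)
qed

lemma has_weak_deriv_classical:
  assumes der: "\<And>x. (f has_real_derivative g x) (at x)" and cont: "continuous_on UNIV g"
  shows "has_weak_deriv f g"
proof -
  have cf: "continuous_on UNIV f"
    using der by (meson DERIV_isCont continuous_at_imp_continuous_on)
  have "(\<integral>x. f x * deriv \<phi> x \<partial>lebesgue) = - (\<integral>x. g x * \<phi> x \<partial>lebesgue)" if \<phi>: "test_function \<phi>" for \<phi>
  proof -
    obtain R where R: "R > 0" "\<And>x. \<bar>x\<bar> \<ge> R \<Longrightarrow> \<phi> x = 0" "\<And>x. \<bar>x\<bar> \<ge> R \<Longrightarrow> deriv \<phi> x = 0"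
      using test_function_supportE[OF \<phi>] by metis
    have sm: "smooth \<phi>" using \<phi> by (simp add: test_function_alt)
    have c: "continuous_on UNIV (\<lambda>x. f x * deriv \<phi> x + g x * \<phi> x)"
      by (intro continuous_intros cf cont smooth_imp_continuous_on smooth_deriv sm)
    have "(\<integral>x. (f x * deriv \<phi> x + g x * \<phi> x) * indicator {-R..R} x \<partial>lborel) = f R * \<phi> R - f (- R) * \<phi> (- R)"
      by (rule integral_FTC_Icc_real)
         (use R(1) c in \<open>auto intro!: derivative_eq_intros der smooth_imp_has_deriv[OF sm]
           simp: continuous_on_eq_continuous_at\<close>)
    moreover have "(f x * deriv \<phi> x + g x * \<phi> x) * indicator {-R..R} x = f x * deriv \<phi> x + g x * \<phi> x" for x
      using R(2,3)[of x] by (cases "\<bar>x\<bar> \<ge> R") (auto simp: indicator_def)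
    ultimately have "(\<integral>x. f x * deriv \<phi> x + g x * \<phi> x \<partial>lborel) = 0"
      using R by simp
    moreover have "(\<lambda>x. f x * deriv \<phi> x + g x * \<phi> x) \<in> borel_measurable borel"
      using c by (rule borel_measurable_continuous_onI)
    ultimately have "(\<integral>x. f x * deriv \<phi> x + g x * \<phi> x \<partial>lebesgue) = 0"
      by (simp add: integral_completion)
    moreover have "integrable lebesgue (\<lambda>x. f x * deriv \<phi> x)" "integrable lebesgue (\<lambda>x. g x * \<phi> x)"
      by (intro integrable_mult_test_function locally_integrable_continuous cf cont \<phi> test_function_deriv)+
    ultimately show ?thesis by simp
  qed
  then show ?thesis
    using cf cont by (simp add: has_weak_deriv_def locally_integrable_continuous)
qed

lemma continuous_imp_antideriv:
  fixes g :: "real \<Rightarrow> real"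
  assumes "continuous_on UNIV g"
  obtains G where "\<And>x. (G has_real_derivative g x) (at x)"
proof -
  define G where "G u = (LBINT y=ereal 0..ereal u. g y)" for u
  have "(G has_real_derivative g x) (at x)" for x
  proof -
    define r where "r = \<bar>x\<bar> + 1"
    have r: "- r < x" "x < r" "0 < r" by (auto simp: r_def)
    have "(G has_vector_derivative g x) (at x within {- r..r})"
      unfolding G_def
      by (rule interval_integral_FTC2) (use r continuous_on_subset[OF assms] in auto)
    then show ?thesis
      using r at_within_Icc_at[of "- r" x r]
      by (simp add: has_real_derivative_iff_has_vector_derivative)
  qed
  then show ?thesis by (rule that)
qed

text \<open>
  If the weak derivative has a continuous representative, the classical antiderivative of the latter
  serves for comparison.
\<close>

lemma has_weak_deriv_continuous_imp_deriv:
  assumes wd: "has_weak_deriv f g" and g: "AE x in lebesgue. g x = G x" and G: "continuous_on UNIV G"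
  obtains F where "\<And>x. (F has_real_derivative G x) (at x)" "AE x in lebesgue. f x = F x"
proof -
  obtain H where H: "\<And>x. (H has_real_derivative G x) (at x)"
    using continuous_imp_antideriv[OF G] by blast
  have wH: "has_weak_deriv H G" using H G by (rule has_weak_deriv_classical)
  obtain c where c: "AE x in lebesgue. f x - H x = c"
  proof (rule AE_const_if_orthogonal_to_derivs)
    show "locally_integrable (\<lambda>x. f x - H x)"
      using wd wH by (auto simp: has_weak_deriv_def intro: locally_integrable_diff)
    fix \<phi> assume \<phi>: "test_function \<phi>"
    note \<phi>' = test_function_deriv[OF \<phi>]
    have "(\<integral>x. g x * \<phi> x \<partial>lebesgue) = (\<integral>x. G x * \<phi> x \<partial>lebesgue)"
      by (rule integral_cong_AE)
         (use wd wH \<phi> g integrable_mult_test_function in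
           \<open>auto simp: has_weak_deriv_def elim!: eventually_mono\<close>)
    then have "(\<integral>x. f x * deriv \<phi> x \<partial>lebesgue) = (\<integral>x. H x * deriv \<phi> x \<partial>lebesgue)"
      using wd wH \<phi> by (simp add: has_weak_deriv_def)
    moreover have "integrable lebesgue (\<lambda>x. f x * deriv \<phi> x)" "integrable lebesgue (\<lambda>x. H x * deriv \<phi> x)"
      using wd wH \<phi>' by (auto simp: has_weak_deriv_def intro: integrable_mult_test_function)
    ultimately show "(\<integral>x. (f x - H x) * deriv \<phi> x \<partial>lebesgue) = 0"
      by (simp add: left_diff_distrib)
  qed
  show ?thesis
  proof (rule that[of "\<lambda>x. H x + c"])
    show "((\<lambda>x. H x + c) has_real_derivative G x) (at x)" for x
      using DERIV_add[OF H DERIV_const] by simp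
    show "AE x in lebesgue. f x = H x + c"
      using c by (rule eventually_mono) simp
  qed
qed

section \<open>Integrals of derivatives over the line\<close>

definition tail_integral :: "(real \<Rightarrow> real) \<Rightarrow> real \<Rightarrow> real" where
  "tail_integral f x = (\<integral>y. indicator {x..} y * f y \<partial>lborel)"

context
  fixes f :: "real \<Rightarrow> real"
  assumes int: "integrable lborel f"
begin

lemma tail_integral_tendsto_0: "(tail_integral f \<longlongrightarrow> 0) at_top"
proof -
  have "((\<lambda>x. \<integral>y. indicator {x..} y * f y \<partial>lborel) \<longlongrightarrow> (\<integral>y. 0 \<partial>(lborel :: real measure))) at_top"
  proof (rule integral_dominated_convergence_at_top[where w = "\<lambda>y. \<bar>f y\<bar>"])
    have "\<forall>\<^sub>F x in at_top. indicator {x..} y * f y = 0" for y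
      using eventually_gt_at_top[of y] by (rule eventually_mono) auto
    then show "AE y in lborel. ((\<lambda>x. indicator {x..} y * f y) \<longlongrightarrow> 0) at_top"
      by (intro AE_I2 tendsto_eventually)
  qed (use int in \<open>auto simp: indicator_def intro!: always_eventually\<close>)
  then show ?thesis by (simp add: tail_integral_def[abs_def])
qed

lemma tail_integral_tendsto_integral: "(tail_integral f \<longlongrightarrow> (\<integral>y. f y \<partial>lborel)) at_bot"
proof -
  have "((\<lambda>x. \<integral>y. indicator {- x..} y * f y \<partial>lborel) \<longlongrightarrow> (\<integral>y. f y \<partial>lborel)) at_top"
  proof (rule integral_dominated_convergence_at_top[where w = "\<lambda>y. \<bar>f y\<bar>"])
    have "\<forall>\<^sub>F x in at_top. indicator {- x..} y * f y = f y" for y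
      using eventually_ge_at_top[of "- y"] by (rule eventually_mono) auto
    then show "AE y in lborel. ((\<lambda>x. indicator {- x..} y * f y) \<longlongrightarrow> f y) at_top"
      by (intro AE_I2 tendsto_eventually)
  qed (use int in \<open>auto simp: indicator_def intro!: always_eventually\<close>)
  then show ?thesis by (simp add: filterlim_at_bot_mirror tail_integral_def)
qed

lemma abs_tail_integral_le: "\<bar>tail_integral f x\<bar> \<le> (\<integral>y. \<bar>f y\<bar> \<partial>lborel)"
proof -
  have "\<bar>tail_integral f x\<bar> \<le> (\<integral>y. \<bar>indicator {x..} y * f y\<bar> \<partial>lborel)"
    unfolding tail_integral_def by (rule integral_abs_bound)
  also have "\<dots> \<le> (\<integral>y. \<bar>f y\<bar> \<partial>lborel)"
    using int integrable_mult_indicator[of "{x..}" lborel f]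
    by (intro integral_mono) (auto simp: indicator_def)
  finally show ?thesis .
qed

text \<open>
  The integrals over \<open>{x..b}\<close> are \<open>G b - G x\<close> and converge as \<open>b\<close> grows; so \<open>G\<close> has a limit at
  infinity, the same for all \<open>x\<close>.
\<close>

lemma tail_integral_antideriv:
  assumes der: "\<And>x. (G has_real_derivative f x) (at x)" and cont: "continuous_on UNIV f"
  obtains L where "\<And>x. tail_integral f x = L - G x" "(G \<longlongrightarrow> L) at_top"
proof -
  have lim: "(G \<longlongrightarrow> tail_integral f x + G x) at_top" for x
  proof -
    have "((\<lambda>b. LINT y:{x..b}|lborel. f y) \<longlongrightarrow> (LINT y:{x..}|lborel. f y)) at_top"
      using int integrable_mult_indicator[of "{x..}" lborel f]
      by (intro tendsto_set_lebesgue_integral_at_top) (auto simp: set_integrable_def)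
    moreover have "\<forall>\<^sub>F b in at_top. (LINT y:{x..b}|lborel. f y) = G b - G x"
      using eventually_ge_at_top[of x]
    proof (rule eventually_mono)
      fix b assume "x \<le> b"
      then have "(\<integral>y. f y * indicator {x..b} y \<partial>lborel) = G b - G x"
        using der cont by (intro integral_FTC_Icc_real) (auto simp: continuous_on_eq_continuous_at)
      then show "(LINT y:{x..b}|lborel. f y) = G b - G x"
        by (simp add: set_lebesgue_integral_def mult.commute)
    qed
    ultimately have "((\<lambda>b. G b - G x) \<longlongrightarrow> tail_integral f x) at_top"
      by (simp add: set_lebesgue_integral_def tail_integral_def tendsto_cong)
    from tendsto_add[OF this tendsto_const[of "G x"]] show ?thesis by simp
  qed
  have "tail_integral f x + G x = tail_integral f 0 + G 0" for x
    by (rule tendsto_unique[OF _ lim lim]) simp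
  then show ?thesis
    using that[of "tail_integral f 0 + G 0"] lim[of 0] by (simp add: algebra_simps)
qed

lemma tail_integral_deriv:
  assumes "continuous_on UNIV f"
  shows "(tail_integral f has_real_derivative - f x) (at x)"
proof -
  obtain G where G: "\<And>x. (G has_real_derivative f x) (at x)"
    using continuous_imp_antideriv[OF assms] by blast
  obtain L where "\<And>x. tail_integral f x = L - G x"
    using tail_integral_antideriv[OF G assms] by blast
  then have "tail_integral f = (\<lambda>x. L - G x)" by auto
  then show ?thesis by (auto intro!: derivative_eq_intros G)
qed

end

lemma integrable_limit_eq_0:
  fixes F :: "real \<Rightarrow> real"
  assumes int: "integrable lborel F" and lim: "(F \<longlongrightarrow> B) at_top"
  shows "B = 0"
proof (rule ccontr)
  assume "B \<noteq> 0"
  then have "((\<lambda>x. \<bar>F x\<bar>) \<longlongrightarrow> \<bar>B\<bar>) at_top" "\<bar>B\<bar> > \<bar>B\<bar> / 2"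
    using lim by (auto intro: tendsto_rabs)
  then have "\<forall>\<^sub>F x in at_top. \<bar>F x\<bar> > \<bar>B\<bar> / 2"
    by (rule order_tendstoD)
  then obtain R where R: "\<And>x. x \<ge> R \<Longrightarrow> \<bar>F x\<bar> > \<bar>B\<bar> / 2"
    by (auto simp: eventually_at_top_linorder)
  have "real n * (\<bar>B\<bar> / 2) \<le> (\<integral>x. \<bar>F x\<bar> \<partial>lborel)" for n :: nat
  proof -
    have "(\<integral>x. indicator {R..R + real n} x * (\<bar>B\<bar> / 2) \<partial>lborel) \<le> (\<integral>x. \<bar>F x\<bar> \<partial>lborel)"
    proof (rule integral_mono)
      show "integrable lborel (\<lambda>x. indicator {R..R + real n} x * (\<bar>B\<bar> / 2))"
        by (intro integrable_mult_left) simp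
      show "indicator {R..R + real n} x * (\<bar>B\<bar> / 2) \<le> \<bar>F x\<bar>" for x
        using R[of x] by (auto simp: indicator_def)
    qed (use int in simp)
    then show ?thesis by simp
  qed
  moreover obtain n :: nat where "(\<integral>x. \<bar>F x\<bar> \<partial>lborel) < real n * (\<bar>B\<bar> / 2)"
    using reals_Archimedean3[of "\<bar>B\<bar> / 2"] \<open>B \<noteq> 0\<close> by auto
  ultimately show False by (simp add: not_less[symmetric])
qed

lemma tendsto_0_if_square_tendsto_0:
  fixes f :: "'a \<Rightarrow> real"
  assumes "((\<lambda>x. (f x)\<^sup>2) \<longlongrightarrow> 0) F"
  shows "(f \<longlongrightarrow> 0) F"
  using tendsto_real_sqrt[OF assms] by (simp add: tendsto_rabs_zero_cancel)

text \<open>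
  Integrability of the derivative yields a limit, and integrability of the function excludes every
  limit but 0. Applied to \<open>(u i)\<^sup>2\<close>, this gives the decay of solutions.
\<close>

lemma integrable_deriv_tendsto_0_at_top:
  assumes der: "\<And>x. (F has_real_derivative f x) (at x)" and cont: "continuous_on UNIV f"
    and int: "integrable lborel f" "integrable lborel F"
  shows "(F \<longlongrightarrow> 0) at_top" and "F x = - tail_integral f x"
proof -
  obtain L where L: "\<And>x. tail_integral f x = L - F x" "(F \<longlongrightarrow> L) at_top"
    using tail_integral_antideriv[OF int(1) der cont] by blast
  moreover have "L = 0" by (rule integrable_limit_eq_0[OF int(2) L(2)])
  ultimately show "(F \<longlongrightarrow> 0) at_top" "F x = - tail_integral f x" by auto
qed

lemma integrable_deriv_tendsto_0_at_bot:
  assumes der: "\<And>x. (F has_real_derivative f x) (at x)" and cont: "continuous_on UNIV f"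
    and int: "integrable lborel f" "integrable lborel F"
  shows "(F \<longlongrightarrow> 0) at_bot"
proof -
  have "((\<lambda>x. F (- x)) \<longlongrightarrow> 0) at_top"
  proof (rule integrable_deriv_tendsto_0_at_top(1))
    show "((\<lambda>x. F (- x)) has_real_derivative - f (- x)) (at x)" for x
      using DERIV_chain'[OF DERIV_minus[OF DERIV_ident] der] by simp
    show "continuous_on UNIV (\<lambda>x. - f (- x))"
      by (intro continuous_intros continuous_on_compose2[OF cont]) auto
    show "integrable lborel (\<lambda>x. - f (- x))" "integrable lborel (\<lambda>x. F (- x))"
      using lborel_integrable_real_affine[OF int(1), of "-1" 0]
        lborel_integrable_real_affine[OF int(2), of "-1" 0] by auto
  qed
  then show ?thesis by (simp add: filterlim_at_bot_mirror)
qed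

lemma integral_deriv_eq_0:
  assumes der: "\<And>x. (F has_real_derivative f x) (at x)" and cont: "continuous_on UNIV f"
    and int: "integrable lborel f" "integrable lborel F"
  shows "(\<integral>x. f x \<partial>lborel) = 0"
proof -
  have "tail_integral f = (\<lambda>x. - F x)"
    using integrable_deriv_tendsto_0_at_top(2)[OF assms] by (intro ext) simp
  then have "((\<lambda>x. - F x) \<longlongrightarrow> (\<integral>x. f x \<partial>lborel)) at_bot"
    using tail_integral_tendsto_integral[OF int(1)] by simp
  moreover have "((\<lambda>x. - F x) \<longlongrightarrow> - 0) at_bot"
    by (intro tendsto_minus integrable_deriv_tendsto_0_at_bot[OF assms])
  ultimately have "(\<integral>x. f x \<partial>lborel) = - 0"
    by (rule tendsto_unique[OF trivial_limit_at_bot_linorder])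
  then show ?thesis by simp
qed

lemma integrable_mult_L2:
  fixes f g :: "real \<Rightarrow> real"
  assumes "integrable lborel (\<lambda>x. (f x)\<^sup>2)" "integrable lborel (\<lambda>x. (g x)\<^sup>2)"
    and "continuous_on UNIV f" "continuous_on UNIV g"
  shows "integrable lborel (\<lambda>x. f x * g x)"
proof (rule Bochner_Integration.integrable_bound)
  show "integrable lborel (\<lambda>x. (f x)\<^sup>2 + (g x)\<^sup>2)" using assms by simp
  show "(\<lambda>x. f x * g x) \<in> borel_measurable lborel"
    using assms(3,4) by (auto intro!: borel_measurable_continuous_onI continuous_intros)
  have "\<bar>f x * g x\<bar> \<le> (f x)\<^sup>2 + (g x)\<^sup>2" for x
  proof -
    have "2 * \<bar>f x * g x\<bar> \<le> (f x)\<^sup>2 + (g x)\<^sup>2"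
      using sum_squares_bound[of "\<bar>f x\<bar>" "\<bar>g x\<bar>"] by (simp add: abs_mult)
    then show ?thesis by linarith
  qed
  then show "AE x in lborel. norm (f x * g x) \<le> norm ((f x)\<^sup>2 + (g x)\<^sup>2)" by simp
qed

section \<open>Differential inequalities\<close>

text \<open>
  Gronwall's inequality, with the exponential as integrating factor.
\<close>

lemma exp_weighted_mono:
  fixes H :: "real \<Rightarrow> real"
  assumes der: "\<And>x. (H has_real_derivative H' x) (at x)" and bound: "\<And>x. - c * H x \<le> H' x"
    and "x \<le> y"
  shows "H x * exp (c * x) \<le> H y * exp (c * y)"
proof (rule DERIV_nonneg_imp_nondecreasing[OF \<open>x \<le> y\<close>])
  fix t
  have "((\<lambda>x. H x * exp (c * x)) has_real_derivative (H' t + c * H t) * exp (c * t)) (at t)"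
    by (auto intro!: derivative_eq_intros der simp: algebra_simps)
  moreover have "(H' t + c * H t) * exp (c * t) \<ge> 0" using bound[of t] by simp
  ultimately show "\<exists>D. ((\<lambda>x. H x * exp (c * x)) has_real_derivative D) (at t) \<and> 0 \<le> D" by blast
qed

lemma vanish_backwards:
  fixes H :: "real \<Rightarrow> real"
  assumes "\<And>x. (H has_real_derivative H' x) (at x)" "\<And>x. - c * H x \<le> H' x"
    and "\<And>x. 0 \<le> H x" "H y = 0" "x \<le> y"
  shows "H x = 0"
  using exp_weighted_mono[OF assms(1,2,5)] assms(3)[of x] assms(4)
  by (auto simp: mult_le_0_iff)

lemma vanish_if_vanish_at_point:
  fixes H :: "real \<Rightarrow> real"
  assumes der: "\<And>x. (H has_real_derivative H' x) (at x)" and bound: "\<And>x. \<bar>H' x\<bar> \<le> c * H x"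
    and nonneg: "\<And>x. 0 \<le> H x" and zero: "H y = 0"
  shows "H x = 0"
proof (cases "x \<le> y")
  case True
  show ?thesis
  proof (rule vanish_backwards[OF der _ nonneg zero True, of c])
    show "- c * H t \<le> H' t" for t using bound[of t] by (simp add: abs_le_iff)
  qed
next
  case False
  have "H (- (- x)) = 0"
  proof (rule vanish_backwards[where H = "\<lambda>t. H (- t)" and y = "- y" and c = c])
    show "((\<lambda>t. H (- t)) has_real_derivative - H' (- t)) (at t)" for t
      using DERIV_chain'[OF DERIV_minus[OF DERIV_ident] der] by simp
    show "- c * H (- t) \<le> - H' (- t)" for t using bound[of "- t"] by (simp add: abs_le_iff)
  qed (use False zero nonneg in auto)
  then show ?thesis by simp
qed

section \<open>Decaying solutions of the coupled system\<close>

text \<open>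
  The classical form of the system for any finite number of components, with \<open>- (k i)\<^sup>2\<close> in place of
  the negative parameter \<open>\<mu> i\<close>.
\<close>

locale decaying_solution =
  fixes I :: "'i set" and k :: "'i \<Rightarrow> real" and u v :: "'i \<Rightarrow> real \<Rightarrow> real"
  assumes finite_I: "finite I"
    and k_pos: "i \<in> I \<Longrightarrow> k i > 0"
    and deriv_u: "i \<in> I \<Longrightarrow> (u i has_real_derivative v i x) (at x)"
    and deriv_v: "i \<in> I \<Longrightarrow>
      (v i has_real_derivative (k i)\<^sup>2 * u i x - 2 * (\<Sum>j\<in>I. (u j x)\<^sup>2) * u i x) (at x)"
    and L2_u: "i \<in> I \<Longrightarrow> integrable lborel (\<lambda>x. (u i x)\<^sup>2)"
    and L2_v: "i \<in> I \<Longrightarrow> integrable lborel (\<lambda>x. (v i x)\<^sup>2)"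
begin

abbreviation Q :: "real \<Rightarrow> real" where
  "Q x \<equiv> \<Sum>j\<in>I. (u j x)\<^sup>2"

abbreviation ddu :: "'i \<Rightarrow> real \<Rightarrow> real" where
  "ddu i x \<equiv> (k i)\<^sup>2 * u i x - 2 * Q x * u i x"

definition gram :: "'i \<Rightarrow> 'i \<Rightarrow> real" where
  "gram i j = (\<integral>x. u i x * u j x \<partial>lborel)"

lemma gram_sym: "gram i j = gram j i"
  by (simp add: gram_def mult.commute)

definition M :: "'i \<Rightarrow> 'i \<Rightarrow> real \<Rightarrow> real" where
  "M i j = tail_integral (\<lambda>x. u i x * u j x)"

lemma cont_u: "i \<in> I \<Longrightarrow> continuous_on A (u i)"
  by (meson DERIV_isCont continuous_at_imp_continuous_on deriv_u)

lemma cont_v: "i \<in> I \<Longrightarrow> continuous_on A (v i)"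
  by (meson DERIV_isCont continuous_at_imp_continuous_on deriv_v)

lemma cont_Q: "continuous_on A Q"
  by (intro continuous_intros cont_u)

lemma int_uu: "i \<in> I \<Longrightarrow> j \<in> I \<Longrightarrow> integrable lborel (\<lambda>x. u i x * u j x)"
  by (intro integrable_mult_L2 L2_u cont_u)

lemma int_uv: "i \<in> I \<Longrightarrow> j \<in> I \<Longrightarrow> integrable lborel (\<lambda>x. u i x * v j x)"
  by (intro integrable_mult_L2 L2_u L2_v cont_u cont_v)

text \<open>
  The function \<open>(u i)\<^sup>2\<close> and its derivative \<open>2 * u i * v i\<close> are both integrable. The bound
  keeps the potential \<open>Q\<close> from spoiling integrability in what follows.
\<close>

lemma
  assumes "i \<in> I"
  shows u_at_top: "(u i \<longlongrightarrow> 0) at_top" and u_at_bot: "(u i \<longlongrightarrow> 0) at_bot"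
    and u_bounded: "(u i x)\<^sup>2 \<le> (\<integral>x. \<bar>2 * (u i x * v i x)\<bar> \<partial>lborel)"
proof -
  have der: "((\<lambda>x. (u i x)\<^sup>2) has_real_derivative 2 * (u i x * v i x)) (at x)" for x
    by (auto intro!: derivative_eq_intros deriv_u assms)
  have cont: "continuous_on UNIV (\<lambda>x. 2 * (u i x * v i x))"
    by (intro continuous_intros cont_u cont_v assms)
  have int: "integrable lborel (\<lambda>x. 2 * (u i x * v i x))"
    using int_uv[OF assms assms] by simp
  show "(u i \<longlongrightarrow> 0) at_top"
    using integrable_deriv_tendsto_0_at_top(1)[OF der cont int L2_u[OF assms]]
    by (rule tendsto_0_if_square_tendsto_0)
  show "(u i \<longlongrightarrow> 0) at_bot"
    using integrable_deriv_tendsto_0_at_bot[OF der cont int L2_u[OF assms]]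
    by (rule tendsto_0_if_square_tendsto_0)
  show "(u i x)\<^sup>2 \<le> (\<integral>x. \<bar>2 * (u i x * v i x)\<bar> \<partial>lborel)"
    using integrable_deriv_tendsto_0_at_top(2)[OF der cont int L2_u[OF assms], of x]
      abs_tail_integral_le[OF int, of x] by simp
qed

lemma Q_bounded:
  obtains B where "\<And>x. Q x \<le> B"
  using that[of "\<Sum>j\<in>I. \<integral>x. \<bar>2 * (u j x * v j x)\<bar> \<partial>lborel"] by (auto intro!: sum_mono u_bounded)

lemma Q_nonneg: "0 \<le> Q x"
  by (intro sum_nonneg) simp

lemma Q_mult_integrable:
  assumes "integrable lborel f"
  shows "integrable lborel (\<lambda>x. Q x * f x)"
proof -
  obtain B where B: "\<And>x. Q x \<le> B" using Q_bounded by blast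
  show ?thesis
  proof (rule Bochner_Integration.integrable_bound)
    show "integrable lborel (\<lambda>x. B * f x)" using assms by simp
    have "Q \<in> borel_measurable borel"
      by (intro borel_measurable_continuous_onI cont_Q)
    then show "(\<lambda>x. Q x * f x) \<in> borel_measurable lborel"
      using assms by simp
    have "\<bar>Q x * f x\<bar> \<le> \<bar>B * f x\<bar>" for x
      using mult_right_mono[OF B[of x], of "\<bar>f x\<bar>"] Q_nonneg[of x] order_trans[OF Q_nonneg B]
      by (simp add: abs_mult)
    then show "AE x in lborel. norm (Q x * f x) \<le> norm (B * f x)" by simp
  qed
qed

lemma v_at_top:
  assumes "i \<in> I"
  shows "(v i \<longlongrightarrow> 0) at_top"
proof -
  have der: "((\<lambda>x. (v i x)\<^sup>2) has_real_derivative 2 * (v i x * ddu i x)) (at x)" for x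
    by (auto intro!: derivative_eq_intros deriv_v assms)
  have cont: "continuous_on UNIV (\<lambda>x. 2 * (v i x * ddu i x))"
    by (intro continuous_intros cont_u cont_v cont_Q assms)
  have "integrable lborel (\<lambda>x. 2 * (k i)\<^sup>2 * (u i x * v i x) - 4 * (Q x * (u i x * v i x)))"
    using int_uv[OF assms assms] Q_mult_integrable[OF int_uv[OF assms assms]] by simp
  then have "integrable lborel (\<lambda>x. 2 * (v i x * ddu i x))"
    by (simp add: algebra_simps)
  from integrable_deriv_tendsto_0_at_top(1)[OF der cont this L2_v[OF assms]]
  show ?thesis by (rule tendsto_0_if_square_tendsto_0)
qed

lemma M_at_top: "i \<in> I \<Longrightarrow> j \<in> I \<Longrightarrow> (M i j \<longlongrightarrow> 0) at_top"
  unfolding M_def by (intro tail_integral_tendsto_0 int_uu)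

lemma M_at_bot: "i \<in> I \<Longrightarrow> j \<in> I \<Longrightarrow> (M i j \<longlongrightarrow> gram i j) at_bot"
  unfolding M_def gram_def by (intro tail_integral_tendsto_integral int_uu)

lemma M_deriv: "i \<in> I \<Longrightarrow> j \<in> I \<Longrightarrow> (M i j has_real_derivative - (u i x * u j x)) (at x)"
  unfolding M_def by (intro tail_integral_deriv int_uu continuous_intros cont_u)

lemma M_sym: "M i j = M j i"
  by (simp add: M_def mult.commute)

text \<open>
  In matrix notation \<open>d = u' + K u - M u\<close> and, below, \<open>C = K M + M K - M\<^sup>2 - u u\<^sup>T\<close>. For a
  multi-soliton solution both are zero by the Gelfand-Levitan equation; the aim is to show that this
  holds for every decaying solution.
\<close>

definition d :: "'i \<Rightarrow> real \<Rightarrow> real" where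
  "d i x = v i x + k i * u i x - (\<Sum>j\<in>I. M i j x * u j x)"

definition C :: "'i \<Rightarrow> 'i \<Rightarrow> real \<Rightarrow> real" where
  "C i j x = (k i + k j) * M i j x - (\<Sum>l\<in>I. M i l x * M l j x) - u i x * u j x"

lemma C_sym: "C i j = C j i"
  by (auto simp: C_def M_sym[of j] M_sym[of _ i] mult.commute add.commute)

text \<open>
  In matrix notation \<open>d' = (K - M) d + C u\<close>: replace \<open>u'\<close> in \<open>(K - M) u'\<close> by
  \<open>d + M u - K u\<close>; the terms without \<open>d\<close> combine to \<open>C u\<close>.
\<close>

lemma d_deriv:
  assumes i: "i \<in> I"
  shows "(d i has_real_derivative
    k i * d i x - (\<Sum>j\<in>I. M i j x * d j x) + (\<Sum>j\<in>I. C i j x * u j x)) (at x)"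
proof -
  have "(d i has_real_derivative
      ddu i x + k i * v i x - (\<Sum>j\<in>I. - (u i x * u j x) * u j x + v j x * M i j x)) (at x)"
    unfolding d_def[abs_def]
    by (intro DERIV_diff DERIV_add DERIV_cmult DERIV_sum DERIV_mult deriv_u deriv_v M_deriv i)
  moreover have "ddu i x + k i * v i x - (\<Sum>j\<in>I. - (u i x * u j x) * u j x + v j x * M i j x)
      = k i * d i x - (\<Sum>j\<in>I. M i j x * d j x) + (\<Sum>j\<in>I. C i j x * u j x)"
  proof -
    define S where "S = (\<Sum>j\<in>I. \<Sum>l\<in>I. M i j x * M j l x * u l x)"
    have 1: "(\<Sum>j\<in>I. M i j x * d j x) =
        (\<Sum>j\<in>I. M i j x * v j x) + (\<Sum>j\<in>I. k j * (M i j x * u j x)) - S"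
      by (simp add: S_def d_def algebra_simps sum.distrib sum_subtractf sum_distrib_left)
    have 2: "(\<Sum>j\<in>I. C i j x * u j x) = k i * (\<Sum>j\<in>I. M i j x * u j x)
        + (\<Sum>j\<in>I. k j * (M i j x * u j x)) - (\<Sum>j\<in>I. \<Sum>l\<in>I. M i l x * M l j x * u j x) - u i x * Q x"
      by (simp add: C_def algebra_simps sum.distrib sum_subtractf sum_distrib_left power2_eq_square)
    have 3: "(\<Sum>j\<in>I. \<Sum>l\<in>I. M i l x * M l j x * u j x) = S"
      unfolding S_def by (rule sum.swap)
    have 4: "(\<Sum>j\<in>I. - (u i x * u j x) * u j x + v j x * M i j x)
        = - (u i x * Q x) + (\<Sum>j\<in>I. M i j x * v j x)"
      by (simp add: algebra_simps sum.distrib sum_subtractf sum_distrib_left power2_eq_square sum_negf)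
    show ?thesis
      unfolding 1 2 3 4 by (simp add: d_def algebra_simps power2_eq_square)
  qed
  ultimately show ?thesis by simp
qed

text \<open>
  In matrix notation \<open>C' = - (d u\<^sup>T + u d\<^sup>T)\<close>, because \<open>M' = - u u\<^sup>T\<close>.
\<close>

lemma C_deriv:
  assumes i: "i \<in> I" and j: "j \<in> I"
  shows "(C i j has_real_derivative - (d i x * u j x + u i x * d j x)) (at x)"
proof -
  have "(C i j has_real_derivative (k i + k j) * - (u i x * u j x)
      - (\<Sum>l\<in>I. - (u i x * u l x) * M l j x + - (u l x * u j x) * M i l x)
      - (v i x * u j x + v j x * u i x)) (at x)"
    unfolding C_def[abs_def]
    by (intro DERIV_diff DERIV_add DERIV_cmult DERIV_sum DERIV_mult deriv_u M_deriv i j)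
  moreover have "(k i + k j) * - (u i x * u j x)
      - (\<Sum>l\<in>I. - (u i x * u l x) * M l j x + - (u l x * u j x) * M i l x)
      - (v i x * u j x + v j x * u i x) = - (d i x * u j x + u i x * d j x)"
  proof -
    have "(\<Sum>l\<in>I. - (u i x * u l x) * M l j x + - (u l x * u j x) * M i l x)
        = - (u i x * (\<Sum>l\<in>I. M j l x * u l x)) - u j x * (\<Sum>l\<in>I. M i l x * u l x)"
      by (simp add: M_sym[of _ j] algebra_simps sum.distrib sum_subtractf sum_distrib_left sum_negf)
    then show ?thesis by (simp add: d_def algebra_simps)
  qed
  ultimately show ?thesis by simp
qed

text \<open>
  The weight 2 is chosen so that the terms with \<open>C\<close> cancel in the derivative: those of
  \<open>2 |d|\<^sup>2\<close> contribute \<open>4 d \<bullet> C u\<close>, those of \<open>|C|\<^sup>2\<close> contribute \<open>- 4 d \<bullet> C u\<close> by the symmetry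
  of \<open>C\<close>.
\<close>

definition lyapunov :: "real \<Rightarrow> real" where
  "lyapunov x = (\<Sum>i\<in>I. 2 * (d i x)\<^sup>2) + (\<Sum>i\<in>I. \<Sum>j\<in>I. (C i j x)\<^sup>2)"

lemma lyapunov_deriv:
  "(lyapunov has_real_derivative
    4 * (\<Sum>i\<in>I. k i * (d i x)\<^sup>2) - 4 * (\<Sum>i\<in>I. \<Sum>j\<in>I. M i j x * (d i x * d j x))) (at x)"
proof -
  define d' where "d' i = k i * d i x - (\<Sum>j\<in>I. M i j x * d j x) + (\<Sum>j\<in>I. C i j x * u j x)" for i
  define C' where "C' i j = - (d i x * u j x + u i x * d j x)" for i j
  have dd: "((\<lambda>x. 2 * (d i x)\<^sup>2) has_real_derivative 4 * (d i x * d' i)) (at x)" if "i \<in> I" for i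
    by (auto intro!: derivative_eq_intros d_deriv[OF that] simp: d'_def)
  have CC: "((\<lambda>x. (C i j x)\<^sup>2) has_real_derivative 2 * (C i j x * C' i j)) (at x)"
    if "i \<in> I" "j \<in> I" for i j
    by (auto intro!: derivative_eq_intros C_deriv[OF that] simp: C'_def)
  have der: "(lyapunov has_real_derivative
      (\<Sum>i\<in>I. 4 * (d i x * d' i)) + (\<Sum>i\<in>I. \<Sum>j\<in>I. 2 * (C i j x * C' i j))) (at x)"
    unfolding lyapunov_def[abs_def] by (intro DERIV_add DERIV_sum dd CC)
  have e1: "(\<Sum>i\<in>I. \<Sum>j\<in>I. 2 * (C i j x * C' i j)) = - 4 * (\<Sum>i\<in>I. \<Sum>j\<in>I. C i j x * (d i x * u j x))"
  proof -
    have "(\<Sum>i\<in>I. \<Sum>j\<in>I. C i j x * (u i x * d j x)) = (\<Sum>j\<in>I. \<Sum>i\<in>I. C i j x * (u i x * d j x))"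
      by (rule sum.swap)
    also have "\<dots> = (\<Sum>i\<in>I. \<Sum>j\<in>I. C i j x * (d i x * u j x))"
      by (intro sum.cong refl) (simp add: C_sym mult.commute)
    finally have *: "(\<Sum>i\<in>I. \<Sum>j\<in>I. C i j x * (u i x * d j x)) = (\<Sum>i\<in>I. \<Sum>j\<in>I. C i j x * (d i x * u j x))" .
    have "(\<Sum>i\<in>I. \<Sum>j\<in>I. 2 * (C i j x * C' i j)) =
        - 2 * ((\<Sum>i\<in>I. \<Sum>j\<in>I. C i j x * (d i x * u j x)) + (\<Sum>i\<in>I. \<Sum>j\<in>I. C i j x * (u i x * d j x)))"
      by (simp add: C'_def algebra_simps sum.distrib sum_subtractf sum_distrib_left sum_negf)
    then show ?thesis unfolding * by simp
  qed
  have e2: "(\<Sum>i\<in>I. 4 * (d i x * d' i)) = 4 * (\<Sum>i\<in>I. k i * (d i x)\<^sup>2)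
      - 4 * (\<Sum>i\<in>I. \<Sum>j\<in>I. M i j x * (d i x * d j x)) + 4 * (\<Sum>i\<in>I. \<Sum>j\<in>I. C i j x * (d i x * u j x))"
    by (simp add: d'_def algebra_simps sum.distrib sum_subtractf sum_distrib_left power2_eq_square)
  have "(\<Sum>i\<in>I. 4 * (d i x * d' i)) + (\<Sum>i\<in>I. \<Sum>j\<in>I. 2 * (C i j x * C' i j))
      = 4 * (\<Sum>i\<in>I. k i * (d i x)\<^sup>2) - 4 * (\<Sum>i\<in>I. \<Sum>j\<in>I. M i j x * (d i x * d j x))"
    unfolding e1 e2 by simp
  from der[unfolded this] show ?thesis .
qed

definition M_norm :: "real \<Rightarrow> real" where
  "M_norm x = (\<Sum>i\<in>I. \<Sum>j\<in>I. \<bar>M i j x\<bar>)"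

lemma M_form_le:
  "\<bar>\<Sum>i\<in>I. \<Sum>j\<in>I. M i j x * (d i x * d j x)\<bar> \<le> M_norm x * (\<Sum>i\<in>I. (d i x)\<^sup>2)"
proof -
  have dle: "\<bar>d i x * d j x\<bar> \<le> (\<Sum>i\<in>I. (d i x)\<^sup>2)" if "i \<in> I" "j \<in> I" for i j
  proof -
    have le: "(d l x)\<^sup>2 \<le> (\<Sum>i\<in>I. (d i x)\<^sup>2)" if "l \<in> I" for l
      using that finite_I by (intro member_le_sum) auto
    have "2 * \<bar>d i x * d j x\<bar> \<le> (d i x)\<^sup>2 + (d j x)\<^sup>2"
      using sum_squares_bound[of "\<bar>d i x\<bar>" "\<bar>d j x\<bar>"] by (simp add: abs_mult)
    then show ?thesis using le[OF that(1)] le[OF that(2)] by simp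
  qed
  have "\<bar>\<Sum>i\<in>I. \<Sum>j\<in>I. M i j x * (d i x * d j x)\<bar> \<le> (\<Sum>i\<in>I. \<Sum>j\<in>I. \<bar>M i j x * (d i x * d j x)\<bar>)"
    by (intro order_trans[OF sum_abs] sum_mono sum_abs)
  also have "\<dots> \<le> (\<Sum>i\<in>I. \<Sum>j\<in>I. \<bar>M i j x\<bar> * (\<Sum>i\<in>I. (d i x)\<^sup>2))"
    by (intro sum_mono) (simp add: abs_mult mult_left_mono dle[unfolded abs_mult])
  finally show ?thesis by (simp add: M_norm_def sum_distrib_right)
qed

lemma lyapunov_nonneg: "0 \<le> lyapunov x"
  unfolding lyapunov_def by (intro add_nonneg_nonneg sum_nonneg) auto

lemma lyapunov_tendsto: "(lyapunov \<longlongrightarrow> 0) at_top"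
proof -
  have d: "(d i \<longlongrightarrow> 0) at_top" if "i \<in> I" for i
  proof -
    have "((\<lambda>x. v i x + k i * u i x - (\<Sum>j\<in>I. M i j x * u j x)) \<longlongrightarrow> 0 + k i * 0 - (\<Sum>j\<in>I. 0 * 0)) at_top"
      by (intro tendsto_intros M_at_top u_at_top v_at_top that)
    then show ?thesis by (simp add: d_def[abs_def])
  qed
  have C: "(C i j \<longlongrightarrow> 0) at_top" if "i \<in> I" "j \<in> I" for i j
  proof -
    have "((\<lambda>x. (k i + k j) * M i j x - (\<Sum>l\<in>I. M i l x * M l j x) - u i x * u j x)
        \<longlongrightarrow> (k i + k j) * 0 - (\<Sum>l\<in>I. 0 * 0) - 0 * 0) at_top"
      by (intro tendsto_intros M_at_top u_at_top v_at_top that)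
    then show ?thesis by (simp add: C_def[abs_def])
  qed
  have "(lyapunov \<longlongrightarrow> (\<Sum>i\<in>I. 2 * 0\<^sup>2) + (\<Sum>i\<in>I. \<Sum>j\<in>I. 0\<^sup>2)) at_top"
    unfolding lyapunov_def[abs_def] by (intro tendsto_intros d C)
  then show ?thesis by simp
qed

text \<open>
  Far to the right \<open>M\<close> is smaller than \<open>K\<close>, hence the function increases there; as it is nonnegative
  and tends to 0, it vanishes there. On the whole line \<open>M\<close> is bounded, which gives a linear
  differential inequality and carries the zero to the left.
\<close>

lemma lyapunov_eq_0: "lyapunov x = 0"
proof -
  define lyapunov' where "lyapunov' x = 4 * (\<Sum>i\<in>I. k i * (d i x)\<^sup>2)
    - 4 * (\<Sum>i\<in>I. \<Sum>j\<in>I. M i j x * (d i x * d j x))" for x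
  have der: "(lyapunov has_real_derivative lyapunov' x) (at x)" for x
    unfolding lyapunov'_def by (rule lyapunov_deriv)
  have "(M_norm \<longlongrightarrow> (\<Sum>i\<in>I. \<Sum>j\<in>I. \<bar>0\<bar>)) at_top"
    unfolding M_norm_def[abs_def] by (intro tendsto_intros M_at_top)
  then have "(M_norm \<longlongrightarrow> 0) at_top" by simp
  then have "\<forall>\<^sub>F x in at_top. \<forall>i\<in>I. M_norm x < k i"
    using finite_I k_pos by (auto intro!: eventually_ball_finite order_tendstoD(2))
  then obtain R where R: "\<And>x i. x \<ge> R \<Longrightarrow> i \<in> I \<Longrightarrow> M_norm x < k i"
    by (auto simp: eventually_at_top_linorder)
  have lyapunov'_nonneg: "lyapunov' x \<ge> 0" if "x \<ge> R" for x
  proof -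
    have "M_norm x * (\<Sum>i\<in>I. (d i x)\<^sup>2) \<le> (\<Sum>i\<in>I. k i * (d i x)\<^sup>2)"
      unfolding sum_distrib_left using R[OF that] by (intro sum_mono mult_right_mono) (auto intro: less_imp_le)
    then show ?thesis using M_form_le[of x] by (simp add: lyapunov'_def abs_le_iff)
  qed
  have right: "lyapunov x = 0" if "x \<ge> R" for x
  proof -
    have "lyapunov x \<le> lyapunov y" if "y \<ge> x" for y
      by (rule DERIV_nonneg_imp_nondecreasing[OF that]) (use der lyapunov'_nonneg \<open>x \<ge> R\<close> in \<open>meson order_trans\<close>)
    then have "lyapunov x \<le> 0"
      by (intro tendsto_lowerbound[OF lyapunov_tendsto]) (auto simp: eventually_at_top_linorder)
    then show ?thesis using lyapunov_nonneg[of x] by simp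
  qed
  define B where "B = (\<Sum>i\<in>I. \<Sum>j\<in>I. \<integral>x. \<bar>u i x * u j x\<bar> \<partial>lborel)"
  have mB: "M_norm x \<le> B" for x
    unfolding M_norm_def B_def M_def by (intro sum_mono abs_tail_integral_le int_uu)
  have "- (2 * B) * lyapunov x \<le> lyapunov' x" for x
  proof -
    define S where "S = (\<Sum>i\<in>I. (d i x)\<^sup>2)"
    have "S \<ge> 0" unfolding S_def by (intro sum_nonneg) simp
    have "B \<ge> 0" unfolding B_def by (intro sum_nonneg) simp
    have "2 * S \<le> lyapunov x"
      unfolding S_def lyapunov_def sum_distrib_left using sum_nonneg[of I "\<lambda>i. \<Sum>j\<in>I. (C i j x)\<^sup>2"]
      by (simp add: sum_nonneg)
    then have "2 * B * (2 * S) \<le> 2 * B * lyapunov x"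
      using \<open>B \<ge> 0\<close> by (intro mult_left_mono) auto
    moreover have "M_norm x * S \<le> B * S" using mB \<open>S \<ge> 0\<close> by (intro mult_right_mono)
    moreover have "(\<Sum>i\<in>I. k i * (d i x)\<^sup>2) \<ge> 0"
      using k_pos by (intro sum_nonneg) (simp add: less_imp_le)
    ultimately show ?thesis
      using M_form_le[of x, folded S_def] by (simp add: lyapunov'_def abs_le_iff)
  qed
  from vanish_backwards[OF der this lyapunov_nonneg right[of "max R x"], of x] show ?thesis by simp
qed

lemma M_identity:
  assumes "i \<in> I" "j \<in> I"
  shows "(k i + k j) * M i j x - (\<Sum>l\<in>I. M i l x * M l j x) = u i x * u j x"
proof -
  have n: "0 \<le> (\<Sum>i\<in>I. 2 * (d i x)\<^sup>2)" "0 \<le> (\<Sum>i\<in>I. \<Sum>j\<in>I. (C i j x)\<^sup>2)"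
    by (intro sum_nonneg; simp)+
  then have "(\<Sum>i\<in>I. \<Sum>j\<in>I. (C i j x)\<^sup>2) = 0"
    using lyapunov_eq_0[of x] unfolding lyapunov_def by linarith
  then have "C i j x = 0"
    using assms finite_I by (simp add: sum_nonneg_eq_0_iff sum_nonneg)
  then show ?thesis by (simp add: C_def)
qed

text \<open>
  The limit of \<open>M_identity\<close> at minus infinity, where \<open>M\<close> becomes the Gram matrix and \<open>u\<close> vanishes.
\<close>

lemma gram_identity:
  assumes "i \<in> I" "j \<in> I"
  shows "(k i + k j) * gram i j = (\<Sum>l\<in>I. gram i l * gram l j)"
proof -
  have "((\<lambda>x. (k i + k j) * M i j x - (\<Sum>l\<in>I. M i l x * M l j x)) \<longlongrightarrow>
      (k i + k j) * gram i j - (\<Sum>l\<in>I. gram i l * gram l j)) at_bot"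
    by (intro tendsto_intros M_at_bot assms)
  moreover have "((\<lambda>x. u i x * u j x) \<longlongrightarrow> 0 * 0) at_bot"
    by (intro tendsto_intros u_at_bot assms)
  ultimately have "(k i + k j) * gram i j - (\<Sum>l\<in>I. gram i l * gram l j) = 0 * 0"
    using assms by (intro tendsto_unique[OF trivial_limit_at_bot_linorder]) (simp_all add: M_identity)
  then show ?thesis by simp
qed

text \<open>
  Let \<open>S\<close>, \<open>P\<close>, \<open>K\<close> be the integral of \<open>|v|\<^sup>2\<close>, the integral of \<open>Q\<^sup>2\<close> and the sum of the \<open>(k i)\<^sup>2\<close>.
  Integrating the derivative of \<open>u i * v i\<close> yields \<open>S + K = 2 * P\<close>. The first integral
  \<open>(\<Sum>i. (v i)\<^sup>2 - (k i)\<^sup>2 * (u i)\<^sup>2) + Q\<^sup>2\<close> is 0 by decay, and its integral yields \<open>S + P = K\<close>. Thus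
  \<open>P = 2 * K / 3\<close> and \<open>S = K / 3\<close>.
\<close>

lemma energy_identity:
  assumes norm: "\<And>i. i \<in> I \<Longrightarrow> gram i i = 1"
  shows "(\<Sum>i\<in>I. \<integral>x. (v i x)\<^sup>2 \<partial>lborel) - (\<integral>x. (Q x)\<^sup>2 \<partial>lborel) = - (1 / 3) * (\<Sum>i\<in>I. (k i)\<^sup>2)"
proof -
  have norm': "(\<integral>x. (u i x)\<^sup>2 \<partial>lborel) = 1" if "i \<in> I" for i
    using norm[OF that] by (simp add: gram_def power2_eq_square)
  define K where "K = (\<Sum>i\<in>I. (k i)\<^sup>2)"
  define S where "S = (\<Sum>i\<in>I. \<integral>x. (v i x)\<^sup>2 \<partial>lborel)"
  define P where "P = (\<integral>x. (Q x)\<^sup>2 \<partial>lborel)"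
  have iQ: "integrable lborel (\<lambda>x. (Q x)\<^sup>2)"
    unfolding power2_eq_square[of "sum _ _"]
    by (intro Q_mult_integrable Bochner_Integration.integrable_sum L2_u)
  have virial: "S + K - 2 * P = 0"
  proof -
    define f where "f i x = (v i x)\<^sup>2 + (k i)\<^sup>2 * (u i x)\<^sup>2 - 2 * (Q x * (u i x)\<^sup>2)" for i x
    have iQu: "integrable lborel (\<lambda>x. Q x * (u i x)\<^sup>2)" if "i \<in> I" for i
      by (intro Q_mult_integrable L2_u that)
    have if': "integrable lborel (f i)" if "i \<in> I" for i
      unfolding f_def[abs_def] using that iQu L2_u L2_v by simp
    have "(\<integral>x. f i x \<partial>lborel) = 0" if i: "i \<in> I" for i
    proof (rule integral_deriv_eq_0)
      show "((\<lambda>x. u i x * v i x) has_real_derivative f i x) (at x)" for x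
        unfolding f_def by (auto intro!: derivative_eq_intros deriv_u deriv_v i simp: power2_eq_square algebra_simps)
      show "continuous_on UNIV (f i)"
        unfolding f_def[abs_def] by (intro continuous_intros cont_u cont_v cont_Q i)
    qed (use if' int_uv i in auto)
    then have "0 = (\<Sum>i\<in>I. \<integral>x. f i x \<partial>lborel)" by simp
    also have "\<dots> = (\<Sum>i\<in>I. (\<integral>x. (v i x)\<^sup>2 \<partial>lborel) + (k i)\<^sup>2 - 2 * (\<integral>x. Q x * (u i x)\<^sup>2 \<partial>lborel))"
      unfolding f_def[abs_def] using iQu L2_u L2_v norm' by (intro sum.cong) auto
    also have "\<dots> = S + K - 2 * (\<Sum>i\<in>I. \<integral>x. Q x * (u i x)\<^sup>2 \<partial>lborel)"
      by (simp add: S_def K_def sum.distrib sum_subtractf sum_distrib_left)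
    also have "(\<Sum>i\<in>I. \<integral>x. Q x * (u i x)\<^sup>2 \<partial>lborel) = (\<integral>x. (\<Sum>i\<in>I. Q x * (u i x)\<^sup>2) \<partial>lborel)"
      using iQu by (rule Bochner_Integration.integral_sum[symmetric])
    also have "\<dots> = P"
      unfolding P_def by (simp add: power2_eq_square sum_distrib_left)
    finally show ?thesis by simp
  qed
  have pohozaev: "S - K + P = 0"
  proof -
    define F where "F x = (\<Sum>i\<in>I. (v i x)\<^sup>2 - (k i)\<^sup>2 * (u i x)\<^sup>2) + (Q x)\<^sup>2" for x
    have "(F has_real_derivative
        (\<Sum>i\<in>I. 2 * v i x * ddu i x - (k i)\<^sup>2 * (2 * u i x * v i x)) + 2 * Q x * (\<Sum>i\<in>I. 2 * u i x * v i x)) (at x)" for x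
      unfolding F_def[abs_def]
      by (auto intro!: derivative_eq_intros DERIV_sum deriv_u deriv_v simp: mult_ac)
    moreover have "(\<Sum>i\<in>I. 2 * v i x * ddu i x - (k i)\<^sup>2 * (2 * u i x * v i x)) + 2 * Q x * (\<Sum>i\<in>I. 2 * u i x * v i x) = 0" for x
    proof -
      define q where "q = Q x"
      have "(\<Sum>i\<in>I. 2 * v i x * ((k i)\<^sup>2 * u i x - 2 * q * u i x) - (k i)\<^sup>2 * (2 * u i x * v i x)) + 2 * q * (\<Sum>i\<in>I. 2 * u i x * v i x) = 0"
        by (simp add: sum_distrib_left flip: sum.distrib) (simp add: algebra_simps)
      then show ?thesis unfolding q_def .
    qed
    ultimately have F': "(F has_real_derivative 0) (at x)" for x by simp
    then have const: "F x = F 0" for x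
      by (metis DERIV_isconst_all)
    have "(F \<longlongrightarrow> (\<Sum>i\<in>I. 0\<^sup>2 - (k i)\<^sup>2 * 0\<^sup>2) + (\<Sum>i\<in>I. 0\<^sup>2)\<^sup>2) at_top"
      unfolding F_def[abs_def] by (intro tendsto_intros u_at_top v_at_top)
    then have "(F \<longlongrightarrow> 0) at_top" by simp
    moreover have "(F \<longlongrightarrow> F 0) at_top"
      using const by (intro tendsto_eventually always_eventually) blast
    ultimately have "F 0 = 0"
      by (intro tendsto_unique[OF trivial_limit_at_top_linorder]) 
    then have "F = (\<lambda>x. 0)" using const by auto
    then have "0 = (\<integral>x. F x \<partial>lborel)" by simp
    also have "\<dots> = (\<Sum>i\<in>I. (\<integral>x. (v i x)\<^sup>2 \<partial>lborel) - (k i)\<^sup>2) + P"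
      unfolding F_def[abs_def] P_def using iQ L2_u L2_v norm' by simp
    also have "\<dots> = S - K + P" by (simp add: S_def K_def sum_subtractf)
    finally show ?thesis by simp
  qed
  from virial pohozaev have "S - P = - (1 / 3) * K" by argo
  then show ?thesis by (simp add: S_def P_def K_def)
qed

text \<open>
  For \<open>k i = k j\<close> the two functions solve the same linear equation, so their Wronskian \<open>W\<close> is constant,
  and it is 0 by decay. The combination \<open>z\<close> then has value and derivative 0 at \<open>y\<close>, and the
  uniqueness theorem for the linear equation makes it vanish identically.
\<close>

lemma proportional_if_same_rate:
  assumes i: "i \<in> I" and j: "j \<in> I" and kk: "k i = k j"
  shows "u i y * u j x = u j y * u i x"
proof -
  define W where "W x = u i x * v j x - u j x * v i x" for x
  have "(W has_real_derivative 0) (at x)" for x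
    unfolding W_def[abs_def]
    by (auto intro!: derivative_eq_intros deriv_u deriv_v i j simp: kk algebra_simps)
  then have const: "W x = W 0" for x by (metis DERIV_isconst_all)
  have "(W \<longlongrightarrow> 0 * 0 - 0 * 0) at_top"
    unfolding W_def[abs_def] by (intro tendsto_intros u_at_top v_at_top i j)
  moreover have "(W \<longlongrightarrow> W 0) at_top"
    using const by (intro tendsto_eventually always_eventually) blast
  ultimately have "W 0 = 0 * 0 - 0 * 0"
    by (intro tendsto_unique[OF trivial_limit_at_top_linorder])
  then have W: "W x = 0" for x using const[of x] by simp
  define z z' where "z x = u i y * u j x - u j y * u i x" and "z' x = u i y * v j x - u j y * v i x" for x
  define q where "q x = (k i)\<^sup>2 - 2 * Q x" for x
  have z: "(z has_real_derivative z' x) (at x)" for x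
    unfolding z_def[abs_def] z'_def by (auto intro!: derivative_eq_intros deriv_u i j)
  have z': "(z' has_real_derivative q x * z x) (at x)" for x
    unfolding z'_def[abs_def] z_def q_def
    by (auto intro!: derivative_eq_intros deriv_v i j simp: kk algebra_simps)
  obtain B where B: "\<And>x. Q x \<le> B" using Q_bounded by blast
  define c where "c = 1 + (k i)\<^sup>2 + 2 * B"
  have qc: "\<bar>1 + q x\<bar> \<le> c" for x
    using B[of x] Q_nonneg[of x] zero_le_power2[of "k i"] unfolding q_def c_def by linarith
  have "(z x)\<^sup>2 + (z' x)\<^sup>2 = 0" for x
  proof (rule vanish_if_vanish_at_point[where H = "\<lambda>x. (z x)\<^sup>2 + (z' x)\<^sup>2" and y = y and c = c])
    show "((\<lambda>x. (z x)\<^sup>2 + (z' x)\<^sup>2) has_real_derivative 2 * (z x * z' x) * (1 + q x)) (at x)" for x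
      by (auto intro!: derivative_eq_intros z z' simp: algebra_simps)
    show "\<bar>2 * (z x * z' x) * (1 + q x)\<bar> \<le> c * ((z x)\<^sup>2 + (z' x)\<^sup>2)" for x
    proof -
      have "\<bar>2 * (z x * z' x)\<bar> \<le> (z x)\<^sup>2 + (z' x)\<^sup>2"
        using sum_squares_bound[of "\<bar>z x\<bar>" "\<bar>z' x\<bar>"] by (simp add: abs_mult)
      then have "\<bar>2 * (z x * z' x)\<bar> * \<bar>1 + q x\<bar> \<le> ((z x)\<^sup>2 + (z' x)\<^sup>2) * c"
        by (intro mult_mono qc) auto
      then show ?thesis by (simp add: abs_mult mult.commute)
    qed
    show "(z y)\<^sup>2 + (z' y)\<^sup>2 = 0"
      using W[of y] by (simp add: z_def z'_def W_def mult.commute)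
  qed simp
  then have "z x = 0" by (simp add: sum_power2_eq_zero_iff)
  then show ?thesis by (simp add: z_def)
qed

end

section \<open>Continuous representatives of weak solutions\<close>

lemma AE_eq_continuous_imp_eq:
  fixes f g :: "real \<Rightarrow> real"
  assumes "AE x in lebesgue. f x = g x" and "continuous_on UNIV f" "continuous_on UNIV g"
  shows "f x = g x"
proof (rule ccontr)
  assume "f x \<noteq> g x"
  define S where "S = {x. f x \<noteq> g x}"
  have "open S"
    unfolding S_def using assms(2,3) by (intro open_Collect_neq) auto
  moreover have "x \<in> S" using \<open>f x \<noteq> g x\<close> by (simp add: S_def)
  moreover have "negligible S"
    using assms(1) by (simp add: S_def eventually_ae_filter_negligible) (meson negligible_subset)
  ultimately show False using open_not_negligible by blast
qed

lemma integral_AE_borel: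
  fixes f F :: "real \<Rightarrow> real"
  assumes "AE x in lebesgue. f x = F x" and "f \<in> borel_measurable lebesgue" and "F \<in> borel_measurable borel"
  shows "(\<integral>x. f x \<partial>lebesgue) = (\<integral>x. F x \<partial>lborel)"
proof -
  have "(\<integral>x. f x \<partial>lebesgue) = (\<integral>x. F x \<partial>lebesgue)"
    using assms by (intro integral_cong_AE) (auto simp: measurable_completion)
  then show ?thesis using assms(3) by (simp add: integral_completion)
qed

lemma integrable_AE_borel:
  fixes f F :: "real \<Rightarrow> real"
  assumes "AE x in lebesgue. f x = F x" and "integrable lebesgue f" and "F \<in> borel_measurable borel"
  shows "integrable lborel F"
proof -
  have "integrable lebesgue F"
    using assms by (intro integrable_cong_AE_imp[OF assms(2)]) (auto simp: measurable_completion)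
  then show ?thesis using assms(3) by (simp add: integrable_completion)
qed

lemma H1_has_weak_deriv:
  assumes "f \<in> H1"
  shows "has_weak_deriv f (weak_deriv f)"
proof -
  obtain g where "has_weak_deriv f g" using assms by (auto simp: H1_def)
  then show ?thesis unfolding weak_deriv_def by (rule someI[where P = "has_weak_deriv f"])
qed

lemma sum_Suc_0_to_3: "(\<Sum>j = Suc 0..3. f j) = f (Suc 0) + f 2 + f 3"
  by (simp add: numeral_eq_Suc)

text \<open>
  Bootstrapping: continuous representatives of the \<open>u i\<close> make the second weak derivatives continuous,
  so \<open>weak_deriv (u i)\<close> and then \<open>u i\<close> have differentiable representatives.
\<close>

lemma H1_solution_classical:
  assumes sol: "H1_solution \<mu> u" and neg: "\<And>i. i \<in> {1..3} \<Longrightarrow> \<mu> i < 0"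
  obtains U V where "decaying_solution {1..3} (\<lambda>i. sqrt (- \<mu> i)) U V"
    and "\<And>i. i \<in> {1..3} \<Longrightarrow> AE x in lebesgue. u i x = U i x"
    and "\<And>i. i \<in> {1..3} \<Longrightarrow> AE x in lebesgue. weak_deriv (u i) x = V i x"
proof -
  have H1: "u i \<in> H1" if "i \<in> {1..3}" for i
    using sol that by (simp add: H1_solution_def)
  have "\<forall>i\<in>{1..3}. \<exists>F. continuous_on UNIV F \<and> (AE x in lebesgue. u i x = F x)"
    using has_weak_deriv_imp_continuous[OF H1_has_weak_deriv[OF H1]] by metis
  then obtain F where F: "\<And>i. i \<in> {1..3} \<Longrightarrow> continuous_on UNIV (F i)"
    "\<And>i. i \<in> {1..3} \<Longrightarrow> AE x in lebesgue. u i x = F i x"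
    by metis
  define W where "W i x = - \<mu> i * F i x - 2 * ((F 1 x)\<^sup>2 + (F 2 x)\<^sup>2 + (F 3 x)\<^sup>2) * F i x" for i x
  have contW: "continuous_on UNIV (W i)" if "i \<in> {1..3}" for i
    unfolding W_def[abs_def] by (intro continuous_intros F that) auto
  have ex: "\<exists>V U. (\<forall>x. (V has_real_derivative W i x) (at x)) \<and> (AE x in lebesgue. weak_deriv (u i) x = V x)
      \<and> (\<forall>x. (U has_real_derivative V x) (at x)) \<and> (AE x in lebesgue. u i x = U x)"
    if i: "i \<in> {1..3}" for i
  proof -
    obtain w where w: "has_weak_deriv (weak_deriv (u i)) w"
      and eq: "AE x in lebesgue. w x + 2 * ((u 1 x)\<^sup>2 + (u 2 x)\<^sup>2 + (u 3 x)\<^sup>2) * u i x = - \<mu> i * u i x"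
      using sol i unfolding H1_solution_def by blast
    have "AE x in lebesgue. w x = W i x"
      using eq F(2)[OF i] F(2)[of 1, simplified] F(2)[of 2, simplified] F(2)[of 3, simplified]
      by eventually_elim (auto simp: W_def algebra_simps)
    then obtain V where V: "\<And>x. (V has_real_derivative W i x) (at x)" "AE x in lebesgue. weak_deriv (u i) x = V x"
      using has_weak_deriv_continuous_imp_deriv[OF w _ contW[OF i]] by blast
    have "continuous_on UNIV V"
      using V(1) by (meson DERIV_isCont continuous_at_imp_continuous_on)
    then obtain U where "\<And>x. (U has_real_derivative V x) (at x)" "AE x in lebesgue. u i x = U x"
      using has_weak_deriv_continuous_imp_deriv[OF H1_has_weak_deriv[OF H1[OF i]] V(2)] by blast
    with V show ?thesis by blast
  qed
  then have "\<forall>i\<in>{1..3}. \<exists>V U. (\<forall>x. (V has_real_derivative W i x) (at x)) \<and>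
      (AE x in lebesgue. weak_deriv (u i) x = V x) \<and>
      (\<forall>x. (U has_real_derivative V x) (at x)) \<and> (AE x in lebesgue. u i x = U x)"
    by blast
  from bchoice[OF this] obtain V where "\<forall>i\<in>{1..3}. \<exists>U. (\<forall>x. (V i has_real_derivative W i x) (at x)) \<and>
      (AE x in lebesgue. weak_deriv (u i) x = V i x) \<and>
      (\<forall>x. (U has_real_derivative V i x) (at x)) \<and> (AE x in lebesgue. u i x = U x)" ..
  from bchoice[OF this] obtain U where UV: "\<forall>i\<in>{1..3}. (\<forall>x. (V i has_real_derivative W i x) (at x)) \<and>
      (AE x in lebesgue. weak_deriv (u i) x = V i x) \<and>
      (\<forall>x. (U i has_real_derivative V i x) (at x)) \<and> (AE x in lebesgue. u i x = U i x)" ..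
  have V: "(V i has_real_derivative W i x) (at x)" "AE x in lebesgue. weak_deriv (u i) x = V i x"
    and U: "(U i has_real_derivative V i x) (at x)" "AE x in lebesgue. u i x = U i x"
    if "i \<in> {1..3}" for i x
    using bspec[OF UV that] by blast+
  have cU: "continuous_on UNIV (U i)" and cV: "continuous_on UNIV (V i)" if "i \<in> {1..3}" for i
    using DERIV_isCont[OF U(1)[OF that]] DERIV_isCont[OF V(1)[OF that]]
    by (auto intro: continuous_at_imp_continuous_on)
  have UF: "F i x = U i x" if i: "i \<in> {1..3}" for i x
  proof (rule AE_eq_continuous_imp_eq[OF _ F(1)[OF i] cU[OF i]])
    show "AE x in lebesgue. F i x = U i x"
      using F(2)[OF i] U(2)[OF i] by eventually_elim simp
  qed
  show ?thesis
  proof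
    show "decaying_solution {1..3} (\<lambda>i. sqrt (- \<mu> i)) U V"
    proof
      fix i :: nat assume i: "i \<in> {1..3}"
      show "sqrt (- \<mu> i) > 0" using neg[OF i] by simp
      show "(U i has_real_derivative V i x) (at x)" for x by (rule U(1)[OF i])
      show "(V i has_real_derivative (sqrt (- \<mu> i))\<^sup>2 * U i x - 2 * (\<Sum>j\<in>{1..3}. (U j x)\<^sup>2) * U i x) (at x)" for x
        using V(1)[OF i, of x] neg[OF i] UF[OF i] UF[of 1] UF[of 2] UF[of 3]
        by (simp add: W_def sum_Suc_0_to_3 algebra_simps)
      have "integrable lebesgue (\<lambda>x. (u i x)\<^sup>2)"
        using H1[OF i] by (simp add: H1_def L2_def)
      moreover have "AE x in lebesgue. (u i x)\<^sup>2 = (U i x)\<^sup>2"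
        using U(2)[OF i] by eventually_elim simp
      ultimately show "integrable lborel (\<lambda>x. (U i x)\<^sup>2)"
        using cU[OF i] by (intro integrable_AE_borel borel_measurable_continuous_onI continuous_intros)
      obtain g where g: "integrable lebesgue (\<lambda>x. (g x)\<^sup>2)" "has_weak_deriv (u i) g"
        using H1[OF i] by (auto simp: H1_def L2_def)
      have "AE x in lebesgue. (g x)\<^sup>2 = (V i x)\<^sup>2"
        using V(2)[OF i] weak_deriv_unique[OF g(2) H1_has_weak_deriv[OF H1[OF i]]]
        by eventually_elim simp
      with g(1) show "integrable lborel (\<lambda>x. (V i x)\<^sup>2)"
        using cV[OF i] by (intro integrable_AE_borel borel_measurable_continuous_onI continuous_intros)
    qed simp
  qed (use U V in auto)
qed

lemma H1_solution_of_classical: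
  assumes "decaying_solution {1..3} k u v"
  shows "H1_solution (\<lambda>i. - (k i)\<^sup>2) u"
proof -
  interpret decaying_solution "{1..3}" k u v by (rule assms)
  have wd: "has_weak_deriv (u i) (v i)" if "i \<in> {1..3}" for i
    using that by (intro has_weak_deriv_classical deriv_u cont_v)
  have L2: "f \<in> L2" if "continuous_on UNIV f" "integrable lborel (\<lambda>x. (f x)\<^sup>2)" for f
    using that borel_measurable_continuous_onI[OF that(1)]
    by (simp add: L2_def measurable_completion integrable_completion)
  have H1: "u i \<in> H1" if i: "i \<in> {1..3}" for i
    using wd[OF i] L2[OF cont_u[OF i] L2_u[OF i]] L2[OF cont_v[OF i] L2_v[OF i]]
    unfolding H1_def by blast
  have "has_weak_deriv (weak_deriv (u i)) (ddu i)" if i: "i \<in> {1..3}" for i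
  proof (rule has_weak_deriv_cong_AE)
    show "has_weak_deriv (v i) (ddu i)"
      using i by (intro has_weak_deriv_classical deriv_v continuous_intros cont_u cont_Q)
    then show "ddu i \<in> borel_measurable lebesgue"
      by (simp add: has_weak_deriv_def locally_integrable_measurable)
    show "AE x in lebesgue. v i x = weak_deriv (u i) x"
      using weak_deriv_unique[OF wd[OF i] H1_has_weak_deriv[OF H1[OF i]]] .
    show "weak_deriv (u i) \<in> borel_measurable lebesgue"
      using H1_has_weak_deriv[OF H1[OF i]] by (simp add: has_weak_deriv_def locally_integrable_measurable)
  qed simp
  moreover have "ddu i x + 2 * ((u 1 x)\<^sup>2 + (u 2 x)\<^sup>2 + (u 3 x)\<^sup>2) * u i x = - (- (k i)\<^sup>2) * u i x" for i x
    by (simp add: sum_Suc_0_to_3 algebra_simps)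
  ultimately show ?thesis
    using H1 unfolding H1_solution_def by blast
qed

lemma gram_eq_lebesgue:
  assumes dec: "decaying_solution {1..3} k U V" and sol: "H1_solution \<mu> u"
    and U: "\<And>i. i \<in> {1..3} \<Longrightarrow> AE x in lebesgue. u i x = U i x"
    and ij: "i \<in> {1..3}" "j \<in> {1..3}"
  shows "(\<integral>x. u i x * u j x \<partial>lebesgue) = decaying_solution.gram U i j"
proof -
  interpret decaying_solution "{1..3}" k U V by (rule dec)
  have um: "u i \<in> borel_measurable lebesgue" if "i \<in> {1..3}" for i
    using sol that by (simp add: H1_solution_def H1_def L2_def)
  show ?thesis
    unfolding gram_def
  proof (rule integral_AE_borel)
    show "AE x in lebesgue. u i x * u j x = U i x * U j x"
      using U[OF ij(1)] U[OF ij(2)] by eventually_elim simp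
    show "(\<lambda>x. u i x * u j x) \<in> borel_measurable lebesgue"
      by (intro borel_measurable_times um ij)
    show "(\<lambda>x. U i x * U j x) \<in> borel_measurable borel"
      by (intro borel_measurable_continuous_onI continuous_intros cont_u ij)
  qed
qed

lemma energy_of_normalized_solution:
  assumes sol: "H1_solution \<mu> u" and neg: "\<And>i. i \<in> {1..3} \<Longrightarrow> \<mu> i < 0" and norm: "normalized u"
  shows "energy u = (\<Sum>i\<in>{1..3}. \<mu> i) / 3"
proof -
  obtain U V where dec: "decaying_solution {1..3} (\<lambda>i. sqrt (- \<mu> i)) U V"
    and U: "\<And>i. i \<in> {1..3} \<Longrightarrow> AE x in lebesgue. u i x = U i x"
    and V: "\<And>i. i \<in> {1..3} \<Longrightarrow> AE x in lebesgue. weak_deriv (u i) x = V i x"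
    using H1_solution_classical[OF sol neg] by blast
  interpret decaying_solution "{1..3}" "\<lambda>i. sqrt (- \<mu> i)" U V by (rule dec)
  have H1: "u i \<in> H1" if "i \<in> {1..3}" for i
    using sol that by (simp add: H1_solution_def)
  have um: "u i \<in> borel_measurable lebesgue" if "i \<in> {1..3}" for i
    using H1[OF that] by (simp add: H1_def L2_def)
  have vm: "weak_deriv (u i) \<in> borel_measurable lebesgue" if "i \<in> {1..3}" for i
    using H1_has_weak_deriv[OF H1[OF that]] by (simp add: has_weak_deriv_def locally_integrable_measurable)
  have "gram i i = 1" if "i \<in> {1..3}" for i
    using gram_eq_lebesgue[OF dec sol U that that] norm that by (simp add: normalized_def power2_eq_square)
  then have "(\<Sum>i\<in>{1..3}. \<integral>x. (V i x)\<^sup>2 \<partial>lborel) - (\<integral>x. (Q x)\<^sup>2 \<partial>lborel)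
      = - (1 / 3) * (\<Sum>i\<in>{1..3}. (sqrt (- \<mu> i))\<^sup>2)"
    by (rule energy_identity)
  also have "\<dots> = (\<Sum>i\<in>{1..3}. \<mu> i) / 3"
  proof -
    have "(sqrt (- \<mu> i))\<^sup>2 = - \<mu> i" if "i \<in> {1..3}" for i
      using neg[OF that] by simp
    then show ?thesis by (simp add: sum_negf)
  qed
  also have "(\<Sum>i\<in>{1..3}. \<integral>x. (V i x)\<^sup>2 \<partial>lborel) = (\<Sum>i\<in>{1..3}. \<integral>x. (weak_deriv (u i) x)\<^sup>2 \<partial>lebesgue)"
  proof (rule sum.cong)
    fix i :: nat assume i: "i \<in> {1..3}"
    show "(\<integral>x. (V i x)\<^sup>2 \<partial>lborel) = (\<integral>x. (weak_deriv (u i) x)\<^sup>2 \<partial>lebesgue)"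
    proof (rule integral_AE_borel[symmetric])
      show "AE x in lebesgue. (weak_deriv (u i) x)\<^sup>2 = (V i x)\<^sup>2" using V[OF i] by eventually_elim simp
    qed (use vm i cont_v in \<open>auto intro!: borel_measurable_continuous_onI continuous_intros\<close>)
  qed simp
  also have "(\<integral>x. (Q x)\<^sup>2 \<partial>lborel) = (\<integral>x. (\<Sum>i\<in>{1..3}. (u i x)\<^sup>2)\<^sup>2 \<partial>lebesgue)"
  proof (rule integral_AE_borel[symmetric])
    show "AE x in lebesgue. (\<Sum>i\<in>{1..3}. (u i x)\<^sup>2)\<^sup>2 = (Q x)\<^sup>2"
      using U[of 1, simplified] U[of 2, simplified] U[of 3, simplified]
      by eventually_elim (simp add: sum_Suc_0_to_3)
    show "(\<lambda>x. (\<Sum>i\<in>{1..3}. (u i x)\<^sup>2)\<^sup>2) \<in> borel_measurable lebesgue"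
      by (intro borel_measurable_power borel_measurable_sum um)
    show "(\<lambda>x. (Q x)\<^sup>2) \<in> borel_measurable borel"
      by (intro borel_measurable_continuous_onI continuous_intros cont_Q)
  qed
  finally show ?thesis by (simp add: energy_def)
qed

section \<open>The triple of equal solitons\<close>

text \<open>
  For three equal components the system becomes \<open>\<phi>'' + 6 * \<phi> ^ 3 = k\<^sup>2 * \<phi>\<close>. Its solution
  \<open>k / (sqrt 3 * cosh (k * x))\<close> has squared norm \<open>2 * k / 3\<close>, whence \<open>k = 3 / 2\<close> for norm 1.
\<close>

definition soliton :: "real \<Rightarrow> real" where
  "soliton x = sqrt 3 / (2 * cosh (3 * x / 2))"

lemma soliton_pos: "soliton x > 0"
  by (simp add: soliton_def)

lemma soliton_square: "(soliton x)\<^sup>2 = 3 / 4 * (1 - (tanh (3 * x / 2))\<^sup>2)"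
proof -
  define c where "c = cosh (3 * x / 2)"
  define s where "s = sinh (3 * x / 2)"
  have "c > 0" "c\<^sup>2 = s\<^sup>2 + 1" by (auto simp: c_def s_def cosh_square_eq)
  then have "s\<^sup>2 = c\<^sup>2 - 1" "c \<noteq> 0" by auto
  then have "1 - (s / c)\<^sup>2 = 1 / c\<^sup>2"
    by (simp add: power_divide diff_divide_distrib)
  then have "3 / (2 * c)\<^sup>2 = 3 / 4 * (1 - (s / c)\<^sup>2)"
    by simp
  then show ?thesis
    by (simp add: soliton_def tanh_def power_divide flip: c_def s_def)
qed

lemma soliton_deriv: "(soliton has_real_derivative - (3 / 2) * tanh (3 * x / 2) * soliton x) (at x)"
  unfolding soliton_def[abs_def]
  by (auto intro!: derivative_eq_intros simp: tanh_def field_simps power2_eq_square)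

lemma continuous_on_soliton: "continuous_on A soliton"
  by (meson DERIV_isCont soliton_deriv continuous_at_imp_continuous_on)

lemma soliton_deriv2:
  "((\<lambda>x. - (3 / 2) * tanh (3 * x / 2) * soliton x) has_real_derivative
    (3 / 2)\<^sup>2 * soliton x - 2 * (3 * (soliton x)\<^sup>2) * soliton x) (at x)"
proof -
  define t where "t = tanh (3 * x / 2)"
  have "((\<lambda>x. - (3 / 2) * tanh (3 * x / 2)) has_real_derivative - (9 / 4) * (1 - t\<^sup>2)) (at x)"
    by (auto intro!: derivative_eq_intros simp: t_def)
  then have "((\<lambda>x. - (3 / 2) * tanh (3 * x / 2) * soliton x) has_real_derivative
      - (9 / 4) * (1 - t\<^sup>2) * soliton x + - (3 / 2) * t * soliton x * (- (3 / 2) * t)) (at x)"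
    unfolding t_def by (rule DERIV_mult[OF _ soliton_deriv])
  moreover have "- (9 / 4) * (1 - t\<^sup>2) * b + - (3 / 2) * t * b * (- (3 / 2) * t)
      = (3 / 2)\<^sup>2 * b - 2 * (3 * (3 / 4 * (1 - t\<^sup>2))) * b" for b
    by algebra
  ultimately show ?thesis
    unfolding soliton_square t_def[symmetric] by metis
qed

text \<open>
  The square of the profile is the derivative of \<open>tanh (3 * x / 2) / 2\<close>, whose limits are \<open>1 / 2\<close> and
  \<open>- 1 / 2\<close>.
\<close>

lemma soliton_L2: "integrable lborel (\<lambda>x. (soliton x)\<^sup>2)" "(\<integral>x. (soliton x)\<^sup>2 \<partial>lborel) = 1"
proof -
  define T where "T x = 1 / 2 * tanh (3 / 2 * x)" for x :: real
  have top: "(T \<longlongrightarrow> 1 / 2) at_top"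
  proof -
    have "((\<lambda>x. 1 / 2 * tanh (3 / 2 * x)) \<longlongrightarrow> 1 / 2 * (1::real)) at_top"
      by (intro tendsto_intros filterlim_compose[OF tanh_real_at_top]
          filterlim_tendsto_pos_mult_at_top[OF tendsto_const _ filterlim_ident]) auto
    then show ?thesis by (simp add: T_def[abs_def])
  qed
  have "((\<lambda>x. T (- x)) \<longlongrightarrow> - (1 / 2)) at_top"
    using tendsto_minus[OF top] by (simp add: T_def[abs_def])
  then have bot: "(T \<longlongrightarrow> - (1 / 2)) at_bot"
    by (simp add: filterlim_at_bot_mirror)
  have der: "(T has_real_derivative (soliton x)\<^sup>2) (at x)" for x
    unfolding T_def[abs_def] soliton_square
    by (auto intro!: derivative_eq_intros simp: field_simps)
  have "set_integrable lborel (einterval (- \<infinity>) \<infinity>) (\<lambda>x. (soliton x)\<^sup>2)"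
    and "(LBINT x=-\<infinity>..\<infinity>. (soliton x)\<^sup>2) = 1 / 2 - (- (1 / 2))"
    by (rule interval_integral_FTC_nonneg[of "-\<infinity>" \<infinity> T];
        use der top bot continuous_on_soliton[of UNIV] in
          \<open>auto simp: ereal_tendsto_simps1 continuous_on_eq_continuous_at intro!: continuous_intros\<close>)+
  then show "integrable lborel (\<lambda>x. (soliton x)\<^sup>2)" "(\<integral>x. (soliton x)\<^sup>2 \<partial>lborel) = 1"
    by (simp_all add: set_integrable_def interval_lebesgue_integral_def set_lebesgue_integral_def)
qed

lemma decaying_solution_soliton:
  assumes "finite I" "card I = 3"
  shows "decaying_solution I (\<lambda>i. 3 / 2) (\<lambda>i. soliton) (\<lambda>i x. - (3 / 2) * tanh (3 * x / 2) * soliton x)"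
proof
  have cont: "continuous_on UNIV (\<lambda>x. - (3 / 2) * tanh (3 * x / 2) * soliton x)"
    using soliton_deriv2 by (meson DERIV_isCont continuous_at_imp_continuous_on)
  show "integrable lborel (\<lambda>x. (- (3 / 2) * tanh (3 * x / 2) * soliton x)\<^sup>2)"
  proof (rule Bochner_Integration.integrable_bound)
    show "integrable lborel (\<lambda>x. 9 / 4 * (soliton x)\<^sup>2)" using soliton_L2 by simp
    show "(\<lambda>x. (- (3 / 2) * tanh (3 * x / 2) * soliton x)\<^sup>2) \<in> borel_measurable lborel"
      using borel_measurable_continuous_onI[OF cont] by simp
    have "(tanh (3 * x / 2))\<^sup>2 \<le> 1" for x :: real
      using tanh_real_bounds[of "3 * x / 2"] by (simp add: abs_square_le_1 abs_le_iff)
    then have "(- (3 / 2) * tanh (3 * x / 2) * soliton x)\<^sup>2 \<le> 9 / 4 * (soliton x)\<^sup>2" for x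
      using mult_right_mono[of "(tanh (3 * x / 2))\<^sup>2" 1 "(soliton x)\<^sup>2"]
      by (simp add: power_mult_distrib power_divide mult.commute)
    then show "AE x in lborel. norm ((- (3 / 2) * tanh (3 * x / 2) * soliton x)\<^sup>2) \<le> norm (9 / 4 * (soliton x)\<^sup>2)"
      by simp
  qed
  show "((\<lambda>x. - (3 / 2) * tanh (3 * x / 2) * soliton x) has_real_derivative
      (3 / 2)\<^sup>2 * soliton x - 2 * (\<Sum>j\<in>I. (soliton x)\<^sup>2) * soliton x) (at x)" for x
    using soliton_deriv2[of x] assms by simp
qed (use assms soliton_L2 soliton_deriv in auto)

lemma soliton_admissible: "(\<lambda>i. soliton) \<in> admissible" and energy_soliton: "energy (\<lambda>i. soliton) = - (9 / 4)"
proof -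
  have sol: "H1_solution (\<lambda>i. - (9 / 4)) (\<lambda>i. soliton)"
    using H1_solution_of_classical[OF decaying_solution_soliton[of "{1..3}"]] by (simp add: power_divide)
  have norm: "normalized (\<lambda>i. soliton)"
    using soliton_L2(2) borel_measurable_continuous_onI[OF continuous_on_soliton]
    by (simp add: normalized_def integral_completion)
  show "(\<lambda>i. soliton) \<in> admissible"
    using sol norm unfolding admissible_def by (auto intro!: exI[of _ "\<lambda>i. - (9 / 4)"])
  show "energy (\<lambda>i. soliton) = - (9 / 4)"
    using energy_of_normalized_solution[OF sol _ norm] by simp
qed

section \<open>Rigidity of extremal Gram matrices\<close>

text \<open>
  By continuity the sign cannot change, as \<open>f\<close> has no zeros.
\<close>

lemma pm_if_square_eq:
  fixes f g :: "real \<Rightarrow> real"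
  assumes cont: "continuous_on UNIV f" and sq: "\<And>x. (f x)\<^sup>2 = (g x)\<^sup>2" and pos: "\<And>x. g x > 0"
  obtains s where "s \<in> {1, -1 :: real}" "\<And>x. f x = s * g x"
proof -
  have nz: "f x \<noteq> 0" for x using sq[of x] pos[of x] by auto
  have conn: "connected (range f)"
    using cont by (intro connected_continuous_image) auto
  have "(\<forall>x. f x > 0) \<or> (\<forall>x. f x < 0)"
  proof (rule ccontr)
    assume "\<not> ?thesis"
    then obtain x y where "f x \<le> 0" "0 \<le> f y" by (auto simp: not_less)
    then have "0 \<in> range f" using connectedD_interval[OF conn, of "f x" "f y" 0] by auto
    then show False using nz by (metis rangeE)
  qed
  then show ?thesis
  proof
    assume "\<forall>x. f x > 0"
    then have "f x = 1 * g x" for x using sq[of x] pos[of x] by (simp add: power2_eq_iff_nonneg less_imp_le)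
    then show ?thesis by (intro that[of 1]) auto
  next
    assume n: "\<forall>x. f x < 0"
    have "f x = - 1 * g x" for x
      using sq[of x] pos[of x] n[rule_format, of x] by (auto simp: power2_eq_iff)
    then show ?thesis by (intro that[of "- 1"]) auto
  qed
qed

text \<open>
  The constant \<open>a\<close> is chosen such that the logistic function agrees with \<open>m\<close> at \<open>x0\<close>. After
  multiplication by the denominator, the difference \<open>z\<close> satisfies the linear equation
  \<open>z' = 3 * m * z\<close>.
\<close>

lemma logistic_unique:
  fixes m :: "real \<Rightarrow> real"
  assumes der: "\<And>x. (m has_real_derivative - (3 * m x * (1 - m x))) (at x)"
    and bound: "\<And>x. \<bar>m x\<bar> \<le> B" and x0: "0 < m x0" "m x0 < 1"
  obtains a where "\<And>x. m x = 1 / (1 + exp (3 * (x - a)))"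
proof -
  define a where "a = x0 - ln (1 / m x0 - 1) / 3"
  define E where "E x = exp (3 * (x - a))" for x
  define z where "z x = m x * (1 + E x) - 1" for x
  have "1 / m x0 - 1 > 0" using x0 by (simp add: field_simps)
  then have "E x0 = 1 / m x0 - 1"
    by (simp add: E_def a_def)
  then have z0: "z x0 = 0" using x0 by (simp add: z_def)
  have dz: "(z has_real_derivative 3 * m x * z x) (at x)" for x
    unfolding z_def[abs_def] E_def[abs_def]
    by (auto intro!: derivative_eq_intros der simp: algebra_simps)
  have "(z x)\<^sup>2 = 0" for x
  proof (rule vanish_if_vanish_at_point[where H = "\<lambda>x. (z x)\<^sup>2" and y = x0 and c = "6 * B"])
    show "((\<lambda>x. (z x)\<^sup>2) has_real_derivative 6 * m x * (z x)\<^sup>2) (at x)" for x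
      by (auto intro!: derivative_eq_intros dz simp: power2_eq_square)
    show "\<bar>6 * m x * (z x)\<^sup>2\<bar> \<le> 6 * B * (z x)\<^sup>2" for x
      using bound[of x] by (simp add: abs_mult mult_right_mono)
  qed (use z0 in auto)
  moreover have "1 + E x > 0" for x by (simp add: E_def add_pos_pos)
  ultimately have "m x = 1 / (1 + E x)" for x
    by (simp add: z_def nonzero_eq_divide_eq less_imp_neq[symmetric])
  then show ?thesis by (intro that[of a]) (simp add: E_def)
qed

lemma soliton_square_logistic:
  "(soliton y)\<^sup>2 = 3 * (1 / (1 + exp (3 * y))) * (1 - 1 / (1 + exp (3 * y)))"
proof -
  define e where "e = exp (3 * y / 2)"
  have e: "e > 0" "exp (3 * y) = e\<^sup>2" by (auto simp: e_def simp flip: exp_double)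
  have "cosh (3 * y / 2) = (e + 1 / e) / 2"
    by (simp add: cosh_def e_def exp_minus inverse_eq_divide)
  then have "soliton y = sqrt 3 / (e + 1 / e)"
    by (simp add: soliton_def)
  also have "\<dots> = sqrt 3 * e / (1 + e\<^sup>2)"
    using e(1) by (simp add: field_simps power2_eq_square)
  finally have "(soliton y)\<^sup>2 = 3 * e\<^sup>2 / (1 + e\<^sup>2)\<^sup>2"
    by (simp add: power_divide power_mult_distrib)
  moreover have "1 + e\<^sup>2 > 0" by (simp add: add_pos_nonneg)
  ultimately show ?thesis unfolding e(2) by (simp add: field_simps power2_eq_square)
qed

lemma (in decaying_solution) gram_integral_diff_square:
  assumes "i \<in> I" "j \<in> I"
  shows "integrable lborel (\<lambda>x. (u i x - c * u j x)\<^sup>2)"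
    and "(\<integral>x. (u i x - c * u j x)\<^sup>2 \<partial>lborel) = gram i i - 2 * c * gram i j + c\<^sup>2 * gram j j"
proof -
  have eq: "(u i x - c * u j x)\<^sup>2 = u i x * u i x - 2 * c * (u i x * u j x) + c\<^sup>2 * (u j x * u j x)" for x
    by (simp add: power2_eq_square algebra_simps)
  show "integrable lborel (\<lambda>x. (u i x - c * u j x)\<^sup>2)"
    unfolding eq using int_uu assms by simp
  show "(\<integral>x. (u i x - c * u j x)\<^sup>2 \<partial>lborel) = gram i i - 2 * c * gram i j + c\<^sup>2 * gram j j"
    unfolding eq gram_def using int_uu assms by simp
qed

text \<open>
  Cauchy-Schwarz: the squared distance of \<open>u i\<close> from its projection to \<open>u j\<close> is \<open>1 - (gram i j)\<^sup>2\<close>.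
\<close>

lemma (in decaying_solution) gram_square_le_1:
  assumes "i \<in> I" "j \<in> I" "gram i i = 1" "gram j j = 1"
  shows "(gram i j)\<^sup>2 \<le> 1"
proof -
  have "0 \<le> (\<integral>x. (u i x - gram i j * u j x)\<^sup>2 \<partial>lborel)" by simp
  also have "\<dots> = 1 - (gram i j)\<^sup>2"
    using gram_integral_diff_square(2)[OF assms(1,2)] assms(3,4) by (simp add: power2_eq_square)
  finally show ?thesis by simp
qed

lemma (in decaying_solution) eq_if_gram_square_eq_1:
  assumes "i \<in> I" "j \<in> I" "gram i i = 1" "gram j j = 1" "(gram i j)\<^sup>2 = 1"
  shows "u i x = gram i j * u j x"
proof (rule AE_eq_continuous_imp_eq[where f = "u i" and g = "\<lambda>x. gram i j * u j x"])
  have "(\<integral>x. (u i x - gram i j * u j x)\<^sup>2 \<partial>lborel) = 0"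
    using gram_integral_diff_square(2)[OF assms(1,2)] assms(3-5) by (simp add: power2_eq_square)
  then have "AE x in lborel. (u i x - gram i j * u j x)\<^sup>2 = 0"
    using gram_integral_diff_square(1)[OF assms(1,2)]
    by (subst (asm) integral_nonneg_eq_0_iff_AE) auto
  then have "AE x in lebesgue. (u i x - gram i j * u j x)\<^sup>2 = 0" by (rule AE_completion)
  then show "AE x in lebesgue. u i x = gram i j * u j x" by (rule eventually_mono) simp
qed (intro continuous_intros cont_u assms)+

text \<open>
  Here \<open>M i j = s j * M i i\<close>, and \<open>M_identity\<close> reduces to the scalar equation
  \<open>3 * M i i - 3 * (M i i)\<^sup>2 = (u i)\<^sup>2\<close>. Since the derivative of \<open>M i i\<close> is \<open>- (u i)\<^sup>2\<close>, this is the
  logistic equation.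
\<close>

lemma (in decaying_solution) equal_profiles_imp_soliton:
  assumes card: "card I = 3" and i: "i \<in> I" and k: "k i = 3 / 2"
    and eq: "\<And>j x. j \<in> I \<Longrightarrow> u j x = s j * u i x" and s: "\<And>j. j \<in> I \<Longrightarrow> (s j)\<^sup>2 = 1"
    and nonzero: "u i x0 \<noteq> 0"
  obtains a t where "t \<in> {1, -1 :: real}" "\<And>x. u i x = t * soliton (x - a)"
proof -
  have Mi: "M i j x = s j * M i i x" if "j \<in> I" for j x
    using eq[OF that] by (simp add: M_def tail_integral_def ac_simps)
  have sq: "3 * M i i x * (1 - M i i x) = (u i x)\<^sup>2" for x
  proof -
    have "(\<Sum>l\<in>I. M i l x * M l i x) = (\<Sum>l\<in>I. (M i i x)\<^sup>2)"
    proof (rule sum.cong)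
      fix l assume l: "l \<in> I"
      have "M i l x * M l i x = (s l)\<^sup>2 * (M i i x)\<^sup>2"
        unfolding M_sym[of l i] Mi[OF l] by (simp add: power2_eq_square)
      then show "M i l x * M l i x = (M i i x)\<^sup>2" using s[OF l] by simp
    qed simp
    then have "3 * M i i x - 3 * (M i i x)\<^sup>2 = (u i x)\<^sup>2"
      using M_identity[OF i i, of x] by (simp add: card k power2_eq_square[of "u i x"])
    then show ?thesis by (simp add: power2_eq_square right_diff_distrib mult.assoc)
  qed
  obtain a where a: "\<And>x. M i i x = 1 / (1 + exp (3 * (x - a)))"
  proof (rule logistic_unique[where m = "M i i" and ?x0.0 = x0])
    show "(M i i has_real_derivative - (3 * M i i x * (1 - M i i x))) (at x)" for x
      using M_deriv[OF i i, of x] by (simp add: sq power2_eq_square)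
    show "\<bar>M i i x\<bar> \<le> (\<integral>x. \<bar>u i x * u i x\<bar> \<partial>lborel)" for x
      unfolding M_def by (intro abs_tail_integral_le int_uu i)
    have "3 * M i i x0 * (1 - M i i x0) > 0"
      using nonzero by (simp add: sq)
    then show "0 < M i i x0" "M i i x0 < 1"
      by (auto simp: zero_less_mult_iff)
  qed (use that in blast)
  have "(u i x)\<^sup>2 = (soliton (x - a))\<^sup>2" for x
    unfolding sq[symmetric] a soliton_square_logistic ..
  then obtain t where "t \<in> {1, -1 :: real}" "\<And>x. u i x = t * soliton (x - a)"
    using pm_if_square_eq[OF cont_u[OF i], of "\<lambda>x. soliton (x - a)"] soliton_pos by metis
  then show ?thesis by (rule that)
qed

section \<open>Least energy and orthonormal solutions\<close>

text \<open>
  Comparison with the triple of equal solitons bounds the sum of the \<open>\<mu> i\<close> from above by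
  \<open>- 27 / 4\<close>, while the Gram identity bounds each of them from below by \<open>- 9 / 4\<close>. Hence equality
  holds in all the Cauchy-Schwarz inequalities.
\<close>

lemma least_energy_solution_is_soliton:
  assumes neg: "\<And>i. i \<in> {1..3} \<Longrightarrow> \<mu> i < 0"
    and least: "least_energy_normalized_solution \<mu> u"
  shows "(\<forall>i\<in>{1..3}. \<mu> i = - 9 / 4) \<and>
    (\<exists>a. \<forall>i\<in>{1..3}. \<exists>s\<in>{1, -1}. AE x in lebesgue. u i x = s * soliton (x - a))"
proof -
  have sol: "H1_solution \<mu> u" and norm: "normalized u"
    and inf: "ereal (energy u) = (INF v\<in>admissible. ereal (energy v))"
    using least by (auto simp: least_energy_normalized_solution_def)
  obtain U V where dec: "decaying_solution {1..3} (\<lambda>i. sqrt (- \<mu> i)) U V"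
    and U: "\<And>i. i \<in> {1..3} \<Longrightarrow> AE x in lebesgue. u i x = U i x"
    and "\<And>i. i \<in> {1..3} \<Longrightarrow> AE x in lebesgue. weak_deriv (u i) x = V i x"
    using H1_solution_classical[OF sol neg] by blast
  interpret decaying_solution "{1..3}" "\<lambda>i. sqrt (- \<mu> i)" U V by (rule dec)
  have gram1: "gram i i = 1" if "i \<in> {1..3}" for i
    using gram_eq_lebesgue[OF dec sol U that that] norm that by (simp add: normalized_def power2_eq_square)
  have kk: "2 * sqrt (- \<mu> i) = (\<Sum>l\<in>{1..3}. (gram i l)\<^sup>2)" if i: "i \<in> {1..3}" for i
  proof -
    have "(\<Sum>l\<in>{1..3}. gram i l * gram l i) = (\<Sum>l\<in>{1..3}. (gram i l)\<^sup>2)"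
      by (intro sum.cong refl) (subst gram_sym[of _ i], simp add: power2_eq_square)
    then show ?thesis using gram_identity[OF i i] gram1[OF i] by simp
  qed
  have gle: "(gram i l)\<^sup>2 \<le> 1" if "i \<in> {1..3}" "l \<in> {1..3}" for i l
    using that gram1 by (intro gram_square_le_1) auto
  have k_le: "sqrt (- \<mu> i) \<le> 3 / 2" if i: "i \<in> {1..3}" for i
  proof -
    have "(\<Sum>l\<in>{1..3::nat}. (gram i l)\<^sup>2) \<le> (\<Sum>l\<in>{1..3::nat}. 1)"
      using gle[OF i] by (intro sum_mono)
    then show ?thesis using kk[OF i] by simp
  qed
  have \<mu>_ge: "- 9 / 4 \<le> \<mu> i" if i: "i \<in> {1..3}" for i
    using power_mono[OF k_le[OF i], of 2] neg[OF i] by (simp add: power_divide)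
  have "energy u \<le> - (9 / 4)"
    using INF_lower[OF soliton_admissible, of "\<lambda>v. ereal (energy v)"] by (simp add: energy_soliton flip: inf)
  then have "(\<Sum>i\<in>{1..3}. \<mu> i) \<le> - 27 / 4"
    using energy_of_normalized_solution[OF sol neg norm] by simp
  then have \<mu>: "\<mu> i = - 9 / 4" if "i \<in> {1..3}" for i
  proof -
    have "i = Suc 0 \<or> i = 2 \<or> i = 3" using that by auto
    then show ?thesis
      using \<open>(\<Sum>i\<in>{1..3}. \<mu> i) \<le> - 27 / 4\<close> \<mu>_ge[of 1] \<mu>_ge[of 2] \<mu>_ge[of 3]
      by (auto simp: sum_Suc_0_to_3)
  qed
  have k: "sqrt (- \<mu> i) = 3 / 2" if "i \<in> {1..3}" for i
    using \<mu>[OF that] real_sqrt_divide[of 9 4] by simp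
  have gram_pm: "(gram i l)\<^sup>2 = 1" if i: "i \<in> {1..3}" and l: "l \<in> {1..3}" for i l
  proof -
    have "(\<Sum>l\<in>{1..3::nat}. 1 - (gram i l)\<^sup>2) = 0"
      using kk[OF i] k[OF i] by (simp add: sum_subtractf)
    then have "\<forall>l\<in>{1..3}. 1 - (gram i l)\<^sup>2 = 0"
      using gle[OF i] by (subst (asm) sum_nonneg_eq_0_iff) auto
    then show ?thesis using l by simp
  qed
  have one: "1 \<in> {1..3::nat}" by simp
  have eq: "U i x = gram i 1 * U 1 x" if "i \<in> {1..3}" for i x
    by (intro eq_if_gram_square_eq_1 gram1 gram_pm that one)
  have "\<exists>x0. U 1 x0 \<noteq> 0"
  proof (rule ccontr)
    assume "\<nexists>x0. U 1 x0 \<noteq> 0"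
    then have "gram 1 1 = 0" by (simp add: gram_def)
    then show False using gram1[OF one] by simp
  qed
  then obtain x0 where x0: "U 1 x0 \<noteq> 0" by blast
  obtain a t where t: "t \<in> {1, -1 :: real}" and a: "\<And>x. U 1 x = t * soliton (x - a)"
  proof (rule equal_profiles_imp_soliton[where i = 1 and s = "\<lambda>j. gram j 1"])
    show "card {1..3::nat} = 3" by simp
    show "U j x = gram j 1 * U 1 x" if "j \<in> {1..3}" for j x by (rule eq[OF that])
    show "(gram j 1)\<^sup>2 = 1" if "j \<in> {1..3}" for j by (rule gram_pm[OF that one])
  qed (use one k x0 that in blast)+
  have "\<exists>s\<in>{1, -1}. AE x in lebesgue. u i x = s * soliton (x - a)" if i: "i \<in> {1..3}" for i
  proof (rule bexI[of _ "gram i 1 * t"])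
    have "U i x = gram i 1 * t * soliton (x - a)" for x
      using eq[OF i, of x] a[of x] by simp
    then show "AE x in lebesgue. u i x = gram i 1 * t * soliton (x - a)"
      using U[OF i] by simp
    have "gram i 1 = 1 \<or> gram i 1 = - 1"
      using gram_pm[OF i one] by (simp add: power2_eq_1_iff)
    then show "gram i 1 * t \<in> {1, -1}" using t by auto
  qed
  with \<mu> show ?thesis by blast
qed

text \<open>
  The Gram identity makes all \<open>k i\<close> equal to \<open>1 / 2\<close>. Integrating the proportionality
  \<open>U 1 y * U 2 x = U 2 y * U 1 x\<close> against \<open>U 2 x\<close> over \<open>x\<close> then shows that \<open>U 1\<close> is zero.
\<close>

lemma no_orthonormal_solution:
  assumes neg: "\<And>i. i \<in> {1..3} \<Longrightarrow> \<mu> i < 0"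
    and sol: "H1_solution \<mu> u"
  shows "\<not> orthonormal u"
proof
  assume orth: "orthonormal u"
  obtain U V where dec: "decaying_solution {1..3} (\<lambda>i. sqrt (- \<mu> i)) U V"
    and U: "\<And>i. i \<in> {1..3} \<Longrightarrow> AE x in lebesgue. u i x = U i x"
    and "\<And>i. i \<in> {1..3} \<Longrightarrow> AE x in lebesgue. weak_deriv (u i) x = V i x"
    using H1_solution_classical[OF sol neg] by blast
  interpret decaying_solution "{1..3}" "\<lambda>i. sqrt (- \<mu> i)" U V by (rule dec)
  have gram: "gram i j = (if i = j then 1 else 0)" if "i \<in> {1..3}" "j \<in> {1..3}" for i j
  proof (cases "i \<le> j")
    case True
    then show ?thesis
      using gram_eq_lebesgue[OF dec sol U that] orth that by (simp add: orthonormal_def)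
  next
    case False
    then show ?thesis
      using gram_eq_lebesgue[OF dec sol U that(2,1)] orth that gram_sym[of i j] by (simp add: orthonormal_def)
  qed
  have k: "sqrt (- \<mu> i) = 1 / 2" if i: "i \<in> {1..3}" for i
  proof -
    have "(\<Sum>l\<in>{1..3}. gram i l * gram l i) = (\<Sum>l\<in>{1..3}. if i = l then 1 else 0)"
      using gram[OF i] gram[OF _ i] by (intro sum.cong) auto
    also have "\<dots> = 1" using i by simp
    finally show ?thesis using gram_identity[OF i i] gram[OF i i] by simp
  qed
  have one: "1 \<in> {1..3::nat}" and two: "2 \<in> {1..3::nat}" by auto
  have "U 1 y = 0" for y
  proof -
    have "U 1 y * U 2 x = U 2 y * U 1 x" for x
      using k[OF one] k[OF two] by (intro proportional_if_same_rate one two) (simp only:)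
    then have "U 1 y * (U 2 x * U 2 x) = U 2 y * (U 1 x * U 2 x)" for x
      by (simp add: mult.assoc[symmetric])
    then have "(\<integral>x. U 1 y * (U 2 x * U 2 x) \<partial>lborel) = (\<integral>x. U 2 y * (U 1 x * U 2 x) \<partial>lborel)"
      by (intro Bochner_Integration.integral_cong refl)
    then have "U 1 y * gram 2 2 = U 2 y * gram 1 2" by (simp add: gram_def)
    then show ?thesis using gram[OF two two] gram[OF one two] by simp
  qed
  then have "gram 1 1 = 0" by (simp add: gram_def)
  then show False using gram[OF one one] by simp
qed

theorem corollary1p3:
  fixes \<mu> :: "nat \<Rightarrow> real"
  assumes "\<mu> 1 \<le> \<mu> 2" and "\<mu> 2 \<le> \<mu> 3" and "\<mu> 3 < 0"
  shows "(\<forall>u. least_energy_normalized_solution \<mu> u \<longrightarrow>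
            \<mu> 1 = - 9 / 4 \<and> \<mu> 2 = - 9 / 4 \<and> \<mu> 3 = - 9 / 4 \<and>
            (\<exists>a::real. \<forall>i\<in>{1..3}. \<exists>s\<in>{1, -1}.
               AE x in lebesgue. u i x = s * (sqrt 3 / (2 * cosh (3 * (x - a) / 2)))))
       \<and> (\<nexists>u. H1_solution \<mu> u \<and> orthonormal u)"
proof -
  have neg: "\<mu> i < 0" if "i \<in> {1..3}" for i
  proof -
    have "i = 1 \<or> i = 2 \<or> i = 3" using that by auto
    then show ?thesis using assms by auto
  qed
  show ?thesis
  proof (intro conjI allI impI)
    fix u assume "least_energy_normalized_solution \<mu> u"
    from least_energy_solution_is_soliton[of \<mu> u, OF neg this]
    show "\<mu> 1 = - 9 / 4" "\<mu> 2 = - 9 / 4" "\<mu> 3 = - 9 / 4"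
      "\<exists>a::real. \<forall>i\<in>{1..3}. \<exists>s\<in>{1, -1}.
         AE x in lebesgue. u i x = s * (sqrt 3 / (2 * cosh (3 * (x - a) / 2)))"
      by (auto simp: soliton_def)
  next
    show "\<nexists>u. H1_solution \<mu> u \<and> orthonormal u"
      using no_orthonormal_solution[of \<mu>, OF neg] by blast
  qed
qed

end
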